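(* Let $t\ge2$ be a positive integer. For each $k$ with $1\le k\le t$, there exists a nonabelian group $$\mathcal{G}\cong(C_4^t\times C_2^{t-k})\rtimes C_2^k$$ (that is, a nonabelian group isomorphic to some semidirect product of this form) that contains a partial difference set with parameters $$\left(2^{3t},\ (2^{2t-1}-2^{t-1})(2^t-1),\ 2^{t-1}+(2^{2t-1}-2^{t-1})(2^{t-1}-2),\ (2^{2t-1}-2^{t-1})(2^{t-1}-1)\right).$$
   Context: A subset $D$ of a finite group $G$ is a $(v,k,\lambda,\mu)$-partial difference set if $|G|=v$, $|D|=k$, every nonidentity $g\in D$ can be expressed as $d_1d_2^{-1}$ with $d_1,d_2\in D$ in exactly $\lambda$ ways, and every $g\in G\setminus(D\cup\{1\})$ can be so expressed in exactly $\mu$ ways. The displayed parameters are called Denniston parameters. $C_n$ denotes the cyclic group of order $n$. *)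

theory Defs
  imports "HOL-Algebra.Algebra"
begin

definition partial_difference_set ::
  "('a, 'm) monoid_scheme \<Rightarrow> 'a set \<Rightarrow> nat \<Rightarrow> nat \<Rightarrow> nat \<Rightarrow> nat \<Rightarrow> bool" where
  "partial_difference_set G D v k l m \<longleftrightarrow>
     group G \<and> finite (carrier G) \<and> D \<subseteq> carrier G \<and> order G = v \<and> card D = k \<and>
     (\<forall>g \<in> D - {\<one>\<^bsub>G\<^esub>}.
        card {(d1, d2). d1 \<in> D \<and> d2 \<in> D \<and> g = d1 \<otimes>\<^bsub>G\<^esub> inv\<^bsub>G\<^esub> d2} = l) \<and>
     (\<forall>g \<in> carrier G - (D \<union> {\<one>\<^bsub>G\<^esub>}).
        card {(d1, d2). d1 \<in> D \<and> d2 \<in> D \<and> g = d1 \<otimes>\<^bsub>G\<^esub> inv\<^bsub>G\<^esub> d2} = m)"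

text \<open>The external semidirect product of \<open>N\<close> by \<open>H\<close>; it is meant to be used with an action
  \<open>\<phi> \<in> hom H (AutoGroup N)\<close>.\<close>

definition semidirect_product ::
  "('a, 'm) monoid_scheme \<Rightarrow> ('b, 'n) monoid_scheme \<Rightarrow> ('b \<Rightarrow> 'a \<Rightarrow> 'a) \<Rightarrow> ('a \<times> 'b) monoid" where
  "semidirect_product N H \<phi> =
     \<lparr>carrier = carrier N \<times> carrier H,
      monoid.mult = (\<lambda>(n, h) (n', h'). (n \<otimes>\<^bsub>N\<^esub> \<phi> h n', h \<otimes>\<^bsub>H\<^esub> h')),
      one = (\<one>\<^bsub>N\<^esub>, \<one>\<^bsub>H\<^esub>)\<rparr>"

text \<open>The direct power \<open>C\<^sub>n\<^sup>m\<close>; for \<open>m = 0\<close> it is the trivial group.\<close>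

definition cyclic_power :: "nat \<Rightarrow> nat \<Rightarrow> (nat \<Rightarrow> int) monoid" where
  "cyclic_power n m = product_group {..<m} (\<lambda>_. integer_mod_group n)"

lemma group_cyclic_power: "group (cyclic_power n m)"
  by (simp add: cyclic_power_def)

lemma group_semidirect_product:
  assumes "group N" "group H" and phi: "\<phi> \<in> hom H (AutoGroup N)"
  shows "group (semidirect_product N H \<phi>)"
proof -
  interpret N: group N by fact
  interpret H: group H by fact
  have aut: "\<phi> h \<in> auto N" if "h \<in> carrier H" for h
    using phi that by (auto simp: hom_def AutoGroup_def)
  have bij: "\<phi> h \<in> Bij (carrier N)" if "h \<in> carrier H" for h
    using aut[OF that] by (simp add: auto_def)
  have closed: "\<phi> h n \<in> carrier N" if "h \<in> carrier H" "n \<in> carrier N" for h n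
    using aut[OF that(1)] that(2) by (auto simp: auto_def hom_def)
  have mult: "\<phi> h (n \<otimes>\<^bsub>N\<^esub> n') = \<phi> h n \<otimes>\<^bsub>N\<^esub> \<phi> h n'"
    if "h \<in> carrier H" "n \<in> carrier N" "n' \<in> carrier N" for h n n'
    using aut[OF that(1)] that(2,3) by (auto simp: auto_def hom_def)
  have comp: "\<phi> (h \<otimes>\<^bsub>H\<^esub> h') n = \<phi> h (\<phi> h' n)"
    if "h \<in> carrier H" "h' \<in> carrier H" "n \<in> carrier N" for h h' n
  proof -
    have "\<phi> (h \<otimes>\<^bsub>H\<^esub> h') = compose (carrier N) (\<phi> h) (\<phi> h')"
      using phi that bij by (simp add: hom_def AutoGroup_def BijGroup_def)
    then show ?thesis using that(3) by (simp add: compose_def)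
  qed
  have one: "\<phi> \<one>\<^bsub>H\<^esub> n = n" if "n \<in> carrier N" for n
    using hom_one[OF phi \<open>group H\<close> N.AutoGroup] that
    by (simp add: AutoGroup_def BijGroup_def)
  show ?thesis
  proof (rule groupI)
    fix x assume "x \<in> carrier (semidirect_product N H \<phi>)"
    then obtain n h where x: "x = (n, h)" "n \<in> carrier N" "h \<in> carrier H"
      by (auto simp: semidirect_product_def)
    let ?y = "(\<phi> (inv\<^bsub>H\<^esub> h) (inv\<^bsub>N\<^esub> n), inv\<^bsub>H\<^esub> h)"
    have "\<phi> (inv\<^bsub>H\<^esub> h) (inv\<^bsub>N\<^esub> n) \<otimes>\<^bsub>N\<^esub> \<phi> (inv\<^bsub>H\<^esub> h) n = \<phi> (inv\<^bsub>H\<^esub> h) \<one>\<^bsub>N\<^esub>"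
      using x mult[of "inv\<^bsub>H\<^esub> h" "inv\<^bsub>N\<^esub> n" n] by simp
    also have "\<dots> = \<one>\<^bsub>N\<^esub>"
      using mult[of "inv\<^bsub>H\<^esub> h" "\<one>\<^bsub>N\<^esub>" "\<one>\<^bsub>N\<^esub>"] closed[of "inv\<^bsub>H\<^esub> h" "\<one>\<^bsub>N\<^esub>"] x by simp
    finally have "?y \<otimes>\<^bsub>semidirect_product N H \<phi>\<^esub> x = \<one>\<^bsub>semidirect_product N H \<phi>\<^esub>"
      using x by (simp add: semidirect_product_def)
    moreover have "?y \<in> carrier (semidirect_product N H \<phi>)"
      using x closed by (simp add: semidirect_product_def)
    ultimately show "\<exists>y \<in> carrier (semidirect_product N H \<phi>).
        y \<otimes>\<^bsub>semidirect_product N H \<phi>\<^esub> x = \<one>\<^bsub>semidirect_product N H \<phi>\<^esub>" by blast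
  qed (auto simp: semidirect_product_def closed mult comp one N.m_assoc H.m_assoc)
qed

end

theory Submission
  imports Defs "HOL-Algebra.Algebraic_Closure_Type" "HOL-Library.Z2"
begin

text \<open>
Let \<open>q = 2^t\<close>, let \<open>F\<close> be the field of order \<open>q\<close> and \<open>N = C\<^sub>4\<^sup>t\<close>. The partial difference set is a
union of blocks \<open>D\<^sub>y \<times> {y}\<close> over the non-zero \<open>y\<close> in \<open>F\<close>, where the \<open>D\<^sub>y\<close> are subsets of \<open>N\<close> of
size \<open>(q\<^sup>2 - q) / 2\<close>. Encode the blocks by signs \<open>s(n, y)\<close>, equal to \<open>-1\<close> for \<open>n\<close> in \<open>D\<^sub>y\<close> and to \<open>1\<close>
otherwise, with \<open>s(n, 0) = q\<close> if \<open>n = 1\<close> and \<open>0\<close> otherwise. Given the block sizes, everything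
follows from the correlation identity \<open>\<Sum>n. s(n, y) s(m n, y + b) = q s(m, b)\<close>
(lemma \<open>dual_sign_correlation\<close>): it determines the number of representations of
\<open>(m, b)\<close> as a difference from \<open>s(m, b)\<close> and from whether \<open>b = 0\<close>.

The identity holds as soon as \<open>q s(\<sqdot>, y)\<close> is the Fourier transform of a function \<open>psi (y f(w))\<close> on
the characters \<open>w\<close> of \<open>N\<close>, with \<open>psi\<close> the canonical additive character of \<open>F\<close>: multiplying two such
functions adds the values of \<open>y\<close>. So one needs a function \<open>f\<close> with values in \<open>F\<close>, all of whose non-zero
multiples are bent with real transforms. Labelling the characters of \<open>N\<close> by pairs \<open>(x, z)\<close> of
field elements (the two binary digits of a vector modulo 4), the function \<open>f(x, z) = z + z\<^sup>2 / x\<close> does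
it: summation over \<open>z\<close> leaves a single value of \<open>x\<close>, and the fourth root of unity that remains there
is \<open>\<plusminus> 1\<close> because its square is \<open>psi\<close> at an element \<open>p + p\<^sup>2\<close>, which has trace zero (lemmas
\<open>transform_eq_phase\<close> and \<open>transform_nonzero\<close>).

As the transforms are real, every block is closed under inversion. Hence the count of differences is
the same in \<open>N \<times> F\<close> and in any semidirect product in which elements of \<open>F\<close> act on \<open>N\<close> trivially or
by inversion (lemma \<open>partial_difference_set_of_twisted_product\<close>). Splitting the additive group of \<open>F\<close>
as \<open>C\<^sub>2\<^sup>t\<^sup>-\<^sup>k \<times> C\<^sub>2\<^sup>k\<close> and letting one coordinate of \<open>C\<^sub>2\<^sup>k\<close> invert \<open>N\<close> gives the required nonabelian
group for every \<open>k \<ge> 1\<close>.\<close>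

section \<open>The finite field of order \<open>2^t\<close> and its additive characters\<close>

text \<open>The derivative of \<open>X^(2^t) - X\<close> is \<open>-1\<close>, so over an algebraically closed field of
characteristic 2 its \<open>2^t\<close> roots are distinct. They form the field of order \<open>2^t\<close>.\<close>

lemma card_roots_frobenius:
  fixes t :: nat
  assumes char2: "CHAR('a::alg_closed_field) = 2" and "t > 0"
  shows "card {x::'a. x ^ (2 ^ t) = x} = 2 ^ t"
proof -
  define p :: "'a poly" where "p = Polynomial.monom 1 (2 ^ t) - Polynomial.monom 1 1"
  have gt: "(2::nat) ^ t > 1"
    using \<open>t > 0\<close> by (rule one_less_power[rotated]) simp
  have coeff_top: "Polynomial.coeff p (2 ^ t) = 1"
    using gt by (simp add: p_def)
  have "Polynomial.degree p \<le> 2 ^ t"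
    unfolding p_def using gt by (intro degree_diff_le degree_monom_le[THEN le_trans]) auto
  moreover have "Polynomial.degree p \<ge> 2 ^ t"
    using coeff_top by (intro le_degree) simp
  ultimately have deg: "Polynomial.degree p = 2 ^ t" by simp
  have "p \<noteq> 0" using coeff_top by auto
  have poly_p: "poly p x = x ^ (2 ^ t) - x" for x
    by (simp add: p_def poly_monom)
  have "of_nat (2 ^ t) = (0::'a)"
    using \<open>t > 0\<close> char2 by (subst of_nat_eq_0_iff_char_dvd) simp
  then have pderiv: "pderiv p = - 1"
    by (simp add: p_def pderiv_diff pderiv_monom)
  have simple: "order x p = 1" if "poly p x = 0" for x
  proof (rule ccontr)
    assume "order x p \<noteq> 1"
    moreover have "order x p \<noteq> 0" using that \<open>p \<noteq> 0\<close> order_root by blast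
    ultimately have "[:-x, 1:] ^ 2 dvd p"
      unfolding order_divides by linarith
    then obtain q where "p = [:-x, 1:] ^ 2 * q" by (elim dvdE)
    then have "poly (pderiv p) x = 0"
      by (simp add: pderiv_mult power2_eq_square del: mult_pCons_left mult_pCons_right)
    then show False by (simp add: pderiv)
  qed
  obtain A where A: "size A = Polynomial.degree p"
      "p = Polynomial.smult (lead_coeff p) (\<Prod>x\<in>#A. [:-x, 1:])"
    using alg_closed_imp_factorization[OF \<open>p \<noteq> 0\<close>] by blast
  have "proots (\<Prod>x\<in>#A. [:-x, 1:]) = A"
    by (induction A) (simp, simp del: mult_pCons_left, subst proots_mult, auto)
  then have "proots p = A"
    using A(2) \<open>p \<noteq> 0\<close> by (metis leading_coeff_0_iff proots_smult)
  then have "2 ^ t = size (proots p)" using A(1) deg by simp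
  also have "\<dots> = (\<Sum>x | poly p x = 0. 1)"
    unfolding size_multiset_overloaded_eq using \<open>p \<noteq> 0\<close> simple by (intro sum.cong) auto
  finally show ?thesis by (simp add: poly_p)
qed

lemma CHAR_bit_alg_closure: "CHAR(bit alg_closure) = 2"
proof -
  have "CHAR(bit) = 2"
    by (rule CHAR_eqI) (simp, metis dvd_0_right even_of_nat)
  then show ?thesis by simp
qed

text \<open>The finite field of order \<open>2^t\<close>, as a subset of some field of characteristic 2, so that its
arithmetic is that of the ambient type.\<close>

locale binary_field =
  fixes F :: "'a::field set" and t :: nat
  assumes char2: "CHAR('a) = 2"
    and t_pos: "t > 0"
    and F_eq: "F = {x. x ^ (2 ^ t) = x}"
    and card_F: "card F = 2 ^ t"
begin

lemma add_self [simp]: "x + x = (0::'a)"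
proof -
  have "(2::'a) = 0"
    using of_nat_CHAR[where ?'a = 'a] by (simp add: char2)
  then show ?thesis by (metis mult_2 mult_zero_left)
qed

lemma add_left_self [simp]: "x + (x + y) = (y::'a)"
  by (simp flip: add.assoc)

lemma minus_eq [simp]: "- x = (x::'a)"
  by (rule minus_unique) simp

lemma diff_eq [simp]: "x - y = x + (y::'a)"
  using diff_conv_add_uminus[of x y] by (simp only: minus_eq)

lemma add_eq_0_iff_eq: "x + y = 0 \<longleftrightarrow> x = (y::'a)"
  using eq_iff_diff_eq_0[of x y] by simp

lemma power2_power_add: "(x + y) ^ (2 ^ n) = x ^ (2 ^ n) + (y::'a) ^ (2 ^ n)"
  by (rule freshmans_dream') (auto simp: char2)

lemma power2_add: "(x + y)\<^sup>2 = x\<^sup>2 + (y::'a)\<^sup>2"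
  using power2_power_add[of x y 1] by simp

lemma power2_eq_iff: "x\<^sup>2 = y\<^sup>2 \<longleftrightarrow> x = (y::'a)"
  by (metis add_eq_0_iff_eq power2_add zero_eq_power2)

lemma finite_F [simp]: "finite F"
  using card_F by (metis card.infinite power_not_zero zero_neq_numeral)

lemma F_0 [simp]: "0 \<in> F" and F_1 [simp]: "1 \<in> F"
  by (auto simp: F_eq)

lemma F_add [simp]: "x \<in> F \<Longrightarrow> y \<in> F \<Longrightarrow> x + y \<in> F"
  by (simp add: F_eq power2_power_add)

lemma F_mult [simp]: "x \<in> F \<Longrightarrow> y \<in> F \<Longrightarrow> x * y \<in> F"
  by (simp add: F_eq power_mult_distrib)

lemma F_inverse [simp]: "x \<in> F \<Longrightarrow> inverse x \<in> F"
  by (simp add: F_eq power_inverse)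

lemma F_divide [simp]: "x \<in> F \<Longrightarrow> y \<in> F \<Longrightarrow> x / y \<in> F"
  by (simp add: divide_inverse)

lemma F_power [simp]: "x \<in> F \<Longrightarrow> x ^ n \<in> F"
  by (induction n) auto

lemma F_sum [simp]: "(\<And>i. i \<in> A \<Longrightarrow> f i \<in> F) \<Longrightarrow> sum f A \<in> F"
  by (induction A rule: infinite_finite_induct) auto

lemma of_int_mod_2 [simp]: "of_int (k mod 2) = (of_int k :: 'a)"
proof -
  have "(of_int k :: 'a) = of_int (k mod 2 + (k div 2 + k div 2))" by simp
  also have "\<dots> = of_int (k mod 2)" by (simp only: of_int_add add_self add_0_right)
  finally show ?thesis ..
qed

definition trace :: "'a \<Rightarrow> 'a" where
  "trace x = (\<Sum>i<t. x ^ (2 ^ i))"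

lemma trace_add: "trace (x + y) = trace x + trace y"
  by (simp add: trace_def power2_power_add sum.distrib)

lemma trace_power2: "(trace x)\<^sup>2 = trace (x\<^sup>2)"
proof -
  have "(\<Sum>i<t. x ^ (2 ^ i))\<^sup>2 = (\<Sum>i<t. (x ^ (2 ^ i))\<^sup>2)"
    by (rule freshmans_dream_sum) (auto simp: char2)
  then show ?thesis
    by (simp add: trace_def mult.commute flip: power_mult)
qed

lemma trace_square:
  assumes "x \<in> F"
  shows "trace (x\<^sup>2) = trace x"
proof -
  have "trace (x\<^sup>2) = (\<Sum>i<t. x ^ (2 ^ Suc i))"
    by (simp add: trace_def flip: power_mult)
  also have "\<dots> + x = (\<Sum>i<Suc t. x ^ (2 ^ i))"
    by (subst sum.lessThan_Suc_shift) (simp add: add.commute)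
  also have "\<dots> = trace x + x"
    using assms by (simp add: trace_def F_eq)
  finally show ?thesis by simp
qed

lemma trace_cases: "x \<in> F \<Longrightarrow> trace x = 0 \<or> trace x = 1"
  using trace_power2[of x] trace_square[of x] by (simp add: power2_eq_square)

text \<open>The trace is a polynomial of degree \<open>2^(t - 1)\<close>, too small to vanish on \<open>2^t\<close> points.\<close>

lemma trace_nonzero: "\<exists>x\<in>F. trace x \<noteq> 0"
proof (rule ccontr)
  assume *: "\<not> ?thesis"
  define p :: "'a poly" where "p = (\<Sum>i<t. Polynomial.monom 1 (2 ^ i))"
  have "Polynomial.coeff p 1 = (\<Sum>i<t. if i = 0 then 1 else 0)"
    by (auto simp: p_def coeff_sum intro!: sum.cong)
  then have "p \<noteq> 0" using t_pos by auto
  have "Polynomial.degree p \<le> 2 ^ (t - 1)"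
    unfolding p_def
    by (intro degree_sum_le) (auto intro!: degree_monom_le[THEN le_trans] power_increasing)
  moreover have "F \<subseteq> {x. poly p x = 0}"
    using * by (auto simp: p_def poly_sum poly_monom trace_def)
  then have "2 ^ t \<le> card {x. poly p x = 0}"
    using card_mono[OF poly_roots_finite[OF \<open>p \<noteq> 0\<close>]] by (simp flip: card_F)
  ultimately have "(2::nat) ^ t \<le> 2 ^ (t - 1)"
    using card_poly_roots_bound[OF \<open>p \<noteq> 0\<close>] by linarith
  then show False using t_pos by simp
qed

text \<open>The canonical additive character of \<open>F\<close>.\<close>

definition psi :: "'a \<Rightarrow> complex" where
  "psi x = (if trace x = 0 then 1 else - 1)"

lemma psi_add: "x \<in> F \<Longrightarrow> y \<in> F \<Longrightarrow> psi (x + y) = psi x * psi y"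
  using trace_cases[of x] trace_cases[of y] by (auto simp: psi_def trace_add)

lemma psi_0 [simp]: "psi 0 = 1"
  using psi_def trace_def t_pos by (auto simp: power_0_left)

lemma psi_square: "x \<in> F \<Longrightarrow> psi (x\<^sup>2) = psi x"
  by (simp add: psi_def trace_square)

lemma psi_times_self [simp]: "psi x * psi x = 1"
  by (simp add: psi_def)

lemma cnj_psi [simp]: "cnj (psi x) = psi x"
  by (simp add: psi_def)

lemma sum_character:
  fixes f :: "'a \<Rightarrow> complex"
  assumes mult: "\<And>x y. x \<in> F \<Longrightarrow> y \<in> F \<Longrightarrow> f (x + y) = f x * f y"
  shows "(\<Sum>x\<in>F. f x) = (if \<forall>x\<in>F. f x = 1 then 2 ^ t else 0)"
proof (cases "\<forall>x\<in>F. f x = 1")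
  case True
  then show ?thesis by (simp add: card_F)
next
  case False
  then obtain a where a: "a \<in> F" "f a \<noteq> 1" by blast
  have "(\<Sum>x\<in>F. f x) = (\<Sum>x\<in>F. f (a + x))"
    by (rule sum.reindex_bij_witness[of _ "\<lambda>x. a + x" "\<lambda>x. a + x"]) (use a in auto)
  also have "\<dots> = f a * (\<Sum>x\<in>F. f x)"
    using a by (simp add: mult sum_distrib_left)
  finally show ?thesis using a by auto
qed

lemma sum_psi:
  assumes "c \<in> F"
  shows "(\<Sum>x\<in>F. psi (c * x)) = (if c = 0 then 2 ^ t else 0)"
proof -
  have "(\<forall>x\<in>F. psi (c * x) = 1) \<longleftrightarrow> c = 0"
  proof
    assume *: "\<forall>x\<in>F. psi (c * x) = 1"
    obtain x where x: "x \<in> F" "trace x \<noteq> 0" using trace_nonzero by blast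
    show "c = 0"
    proof (rule ccontr)
      assume "c \<noteq> 0"
      then have "psi x = 1" using *[rule_format, of "x / c"] assms x by simp
      with x show False by (simp add: psi_def)
    qed
  qed auto
  then show ?thesis
    using sum_character[of "\<lambda>x. psi (c * x)"] assms
    by (simp add: distrib_left psi_add)
qed

text \<open>Double counting: the sum of \<open>f x * psi (c * x)\<close> over all \<open>c\<close> and \<open>x\<close> is \<open>2^t\<close>, hence for
some \<open>c\<close> the character \<open>f x * psi (c * x)\<close> has a non-zero sum and is therefore trivial.\<close>

lemma character_is_psi:
  fixes f :: "'a \<Rightarrow> complex"
  assumes mult: "\<And>x y. x \<in> F \<Longrightarrow> y \<in> F \<Longrightarrow> f (x + y) = f x * f y" and f0: "f 0 = 1"
  shows "\<exists>c\<in>F. \<forall>x\<in>F. f x = psi (c * x)"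
proof -
  have "(\<Sum>c\<in>F. \<Sum>x\<in>F. f x * psi (c * x)) = (\<Sum>x\<in>F. f x * (\<Sum>c\<in>F. psi (x * c)))"
    by (subst sum.swap) (simp add: sum_distrib_left mult.commute)
  also have "\<dots> = (\<Sum>x\<in>F. if x = 0 then 2 ^ t else 0)"
    using f0 by (intro sum.cong) (auto simp: sum_psi)
  also have "\<dots> \<noteq> 0" by simp
  finally obtain c where c: "c \<in> F" "(\<Sum>x\<in>F. f x * psi (c * x)) \<noteq> 0"
    by (meson sum.not_neutral_contains_not_neutral)
  have "\<forall>x\<in>F. f x * psi (c * x) = 1"
    using sum_character[of "\<lambda>x. f x * psi (c * x)"] c
    by (auto simp: mult distrib_left psi_add mult_ac split: if_splits)
  then have "f x = psi (c * x)" if "x \<in> F" for x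
    using that psi_times_self[of "c * x"] by (metis mult.assoc mult_1 mult_1_right)
  with c show ?thesis by blast
qed

lemma add_eq_sym_diff:
  assumes "finite A" "finite B"
  shows "(\<Sum>i\<in>A. f i) + (\<Sum>i\<in>B. f i) = (\<Sum>i\<in>(A - B) \<union> (B - A). f i :: 'a)"
proof -
  have "(\<Sum>i\<in>A. f i) = (\<Sum>i\<in>A \<inter> B. f i) + (\<Sum>i\<in>A - B. f i)"
       "(\<Sum>i\<in>B. f i) = (\<Sum>i\<in>A \<inter> B. f i) + (\<Sum>i\<in>B - A. f i)"
    using assms sum.Int_Diff by (metis, metis Int_commute)
  moreover have "(\<Sum>i\<in>(A - B) \<union> (B - A). f i) = (\<Sum>i\<in>A - B. f i) + (\<Sum>i\<in>B - A. f i)"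
    using assms by (intro sum.union_disjoint) auto
  ultimately show ?thesis
    by (simp add: add_ac)
qed

text \<open>A basis of \<open>F\<close> over the field with two elements, built by adding vectors outside the current span
as long as the span has fewer than \<open>2^t\<close> elements. Since the only scalars are 0 and 1, linear
combinations are subset sums.\<close>

lemma basis_exists:
  "\<exists>\<alpha>. bij_betw (\<lambda>S. \<Sum>i\<in>S. \<alpha> i) (Pow {..<t}) F"
proof -
  have "\<exists>\<alpha>. \<alpha> ` {..<m} \<subseteq> F \<and> inj_on (\<lambda>S. \<Sum>i\<in>S. \<alpha> i :: 'a) (Pow {..<m})" if "m \<le> t" for m
    using that
  proof (induction m)
    case (Suc m)
    then obtain \<alpha> where \<alpha>: "\<alpha> ` {..<m} \<subseteq> F" "inj_on (\<lambda>S. \<Sum>i\<in>S. \<alpha> i :: 'a) (Pow {..<m})"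
      by auto
    define V where "V = (\<lambda>S. \<Sum>i\<in>S. \<alpha> i) ` Pow {..<m}"
    have "card V \<le> 2 ^ m"
      unfolding V_def using card_image_le[of "Pow {..<m}"] by (simp add: card_Pow)
    also have "\<dots> < card F" using Suc.prems by (simp add: card_F)
    finally have "\<not> F \<subseteq> V" using card_mono[of V F] by (auto simp: V_def)
    then obtain \<beta> where \<beta>: "\<beta> \<in> F" "\<beta> \<notin> V" by blast
    define \<alpha>' where "\<alpha>' = \<alpha>(m := \<beta>)"
    have old: "(\<Sum>i\<in>S. \<alpha>' i) = (\<Sum>i\<in>S. \<alpha> i)" if "S \<subseteq> {..<m}" for S
      using that by (intro sum.cong) (auto simp: \<alpha>'_def)
    have new: "(\<Sum>i\<in>S. \<alpha>' i) = \<beta> + (\<Sum>i\<in>S - {m}. \<alpha> i)" if "S \<subseteq> {..<Suc m}" "m \<in> S" for S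
    proof -
      have "finite S" using that finite_subset by blast
      then have "(\<Sum>i\<in>S. \<alpha>' i) = \<alpha>' m + (\<Sum>i\<in>S - {m}. \<alpha>' i)"
        using that by (simp add: sum.remove)
      also have "(\<Sum>i\<in>S - {m}. \<alpha>' i) = (\<Sum>i\<in>S - {m}. \<alpha> i)"
        using that by (intro old) (auto simp: less_Suc_eq)
      finally show ?thesis by (simp add: \<alpha>'_def)
    qed
    have mixed: False
      if "S \<subseteq> {..<Suc m}" "m \<in> S" "T \<subseteq> {..<m}" "(\<Sum>i\<in>S. \<alpha>' i) = (\<Sum>i\<in>T. \<alpha>' i)" for S T
    proof -
      have fin: "finite (S - {m})" "finite T" 
        using that finite_subset[of _ "{..<Suc m}"] finite_subset[of T "{..<m}"] by auto
      have "\<beta> + (\<Sum>i\<in>S - {m}. \<alpha> i) = (\<Sum>i\<in>T. \<alpha> i)"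
        using that new old by simp
      then have "\<beta> = (\<Sum>i\<in>S - {m}. \<alpha> i) + (\<Sum>i\<in>T. \<alpha> i)"
        by (metis add.commute add_left_self)
      also have "\<dots> \<in> V"
        unfolding V_def using that fin
        by (subst add_eq_sym_diff) (force simp: less_Suc_eq intro!: imageI)+
      finally show False using \<beta> by simp
    qed
    have "inj_on (\<lambda>S. \<Sum>i\<in>S. \<alpha>' i) (Pow {..<Suc m})"
    proof (rule inj_onI)
      fix S T assume ST: "S \<in> Pow {..<Suc m}" "T \<in> Pow {..<Suc m}"
        and eq: "(\<Sum>i\<in>S. \<alpha>' i) = (\<Sum>i\<in>T. \<alpha>' i)"
      have low: "U \<subseteq> {..<m}" if "U \<in> Pow {..<Suc m}" "m \<notin> U" for U
        using that by (auto simp: less_Suc_eq)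
      consider "m \<in> S" "m \<in> T" | "m \<notin> S" "m \<notin> T" | "m \<in> S" "m \<notin> T" | "m \<notin> S" "m \<in> T" by blast
      then show "S = T"
      proof cases
        case 1
        then have "(\<Sum>i\<in>S - {m}. \<alpha> i) = (\<Sum>i\<in>T - {m}. \<alpha> i)"
          using eq ST new by simp
        moreover have "S - {m} \<in> Pow {..<m}" "T - {m} \<in> Pow {..<m}"
          using ST by (auto simp: less_Suc_eq)
        ultimately have "S - {m} = T - {m}" by (rule inj_onD[OF \<alpha>(2)])
        then show ?thesis using 1 by blast
      next
        case 2
        with eq ST low old have "(\<Sum>i\<in>S. \<alpha> i) = (\<Sum>i\<in>T. \<alpha> i)" by simp
        then show ?thesis using low ST 2 by (intro inj_onD[OF \<alpha>(2)]) auto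
      next
        case 3
        then show ?thesis using mixed[of S T] low[of T] ST eq by auto
      next
        case 4
        then show ?thesis using mixed[of T S] low[of S] ST eq by auto
      qed
    qed
    moreover have "\<alpha>' ` {..<Suc m} \<subseteq> F"
      using \<alpha>(1) \<beta> by (auto simp: \<alpha>'_def less_Suc_eq)
    ultimately show ?case by blast
  qed auto
  then obtain \<alpha> where \<alpha>: "\<alpha> ` {..<t} \<subseteq> F" "inj_on (\<lambda>S. \<Sum>i\<in>S. \<alpha> i :: 'a) (Pow {..<t})"
    by blast
  have "(\<lambda>S. \<Sum>i\<in>S. \<alpha> i) ` Pow {..<t} = F"
  proof (rule card_subset_eq)
    show "(\<lambda>S. \<Sum>i\<in>S. \<alpha> i) ` Pow {..<t} \<subseteq> F"
      using \<alpha>(1) by (auto intro!: F_sum)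
    show "card ((\<lambda>S. \<Sum>i\<in>S. \<alpha> i) ` Pow {..<t}) = card F"
      using \<alpha>(2) by (simp add: card_image card_F card_Pow)
  qed simp
  with \<alpha>(2) show ?thesis unfolding bij_betw_def by blast
qed

end

section \<open>Homocyclic groups and fourth roots of unity\<close>

lemma carrier_cyclic_power:
  "n > 0 \<Longrightarrow> carrier (cyclic_power n m) = (\<Pi>\<^sub>E i\<in>{..<m}. {0..<int n})"
  by (simp add: cyclic_power_def carrier_integer_mod_group)

lemma mult_cyclic_power:
  "x \<otimes>\<^bsub>cyclic_power n m\<^esub> y = (\<lambda>i\<in>{..<m}. (x i + y i) mod int n)"
  by (simp add: cyclic_power_def)

lemma one_cyclic_power: "\<one>\<^bsub>cyclic_power n m\<^esub> = (\<lambda>i\<in>{..<m}. 0)"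
  by (simp add: cyclic_power_def)

lemma inv_cyclic_power:
  assumes "x \<in> carrier (cyclic_power n m)"
  shows "inv\<^bsub>cyclic_power n m\<^esub> x = (\<lambda>i\<in>{..<m}. (- x i) mod int n)"
proof -
  have "x i \<in> carrier (integer_mod_group n)" if "i < m" for i
    using assms that by (auto simp: cyclic_power_def)
  then show ?thesis
    using assms by (auto simp: cyclic_power_def intro!: restrict_ext)
qed

lemma finite_cyclic_power: "n > 0 \<Longrightarrow> finite (carrier (cyclic_power n m))"
  by (simp add: carrier_cyclic_power finite_PiE)

lemma card_cyclic_power: "n > 0 \<Longrightarrow> card (carrier (cyclic_power n m)) = n ^ m"
  by (simp add: carrier_cyclic_power card_PiE)

lemma i_powi_mod_4: "\<i> powi (k mod 4) = \<i> powi k"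
proof -
  have "\<i> powi k = \<i> powi (4 * (k div 4) + k mod 4)" by simp
  also have "\<dots> = (\<i> powi 4) powi (k div 4) * \<i> powi (k mod 4)"
    by (subst power_int_add) (simp_all add: power_int_mult)
  also have "\<i> powi 4 = 1" by (simp add: power_int_def)
  finally show ?thesis by simp
qed

lemma i_powi_add: "\<i> powi (k + l) = \<i> powi k * \<i> powi l"
  by (simp add: power_int_add)

lemma cnj_i_powi: "cnj (\<i> powi k) = \<i> powi (- k)"
  by (simp add: power_int_minus flip: power_int_inverse)

lemma sum_i_powi:
  assumes "\<bar>c\<bar> < 4"
  shows "(\<Sum>a\<in>{0..<4}. \<i> powi (a * c)) = (if c = 0 then 4 else 0)"
proof -
  have "{0..<4::int} = {0, 1, 2, 3}" by auto
  then have *: "(\<Sum>a\<in>{0..<4}. \<i> powi (a * c)) = 1 + \<i> powi c + \<i> powi (2 * c) + \<i> powi (3 * c)"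
    by simp
  have "c \<in> {-3, -2, -1, 0, 1, 2, 3}" using assms by auto
  then show ?thesis
    unfolding * by (auto simp: power_int_def power_numeral_reduce)
qed

section \<open>Characters of the homocyclic group in field coordinates\<close>

locale binary_field_basis = binary_field F t for F :: "'a::field set" and t +
  fixes \<alpha> :: "nat \<Rightarrow> 'a"
  assumes basis: "bij_betw (\<lambda>S. \<Sum>i\<in>S. \<alpha> i) (Pow {..<t}) F"
begin

definition digits :: "'a \<Rightarrow> nat set" where
  "digits = inv_into (Pow {..<t}) (\<lambda>S. \<Sum>i\<in>S. \<alpha> i)"

lemma digits_subset: "x \<in> F \<Longrightarrow> digits x \<subseteq> {..<t}"
  using bij_betwE[OF bij_betw_inv_into[OF basis]] by (auto simp: digits_def)

lemma finite_digits [simp]: "x \<in> F \<Longrightarrow> finite (digits x)"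
  using digits_subset finite_subset by blast

lemma sum_digits: "x \<in> F \<Longrightarrow> (\<Sum>i\<in>digits x. \<alpha> i) = x"
  using bij_betw_inv_into_right[OF basis] by (simp add: digits_def)

lemma digits_unique: "S \<subseteq> {..<t} \<Longrightarrow> digits (\<Sum>i\<in>S. \<alpha> i) = S"
  using bij_betw_inv_into_left[OF basis] by (simp add: digits_def)

lemma digits_0 [simp]: "digits 0 = {}"
  using digits_unique[of "{}"] by simp

lemma digits_eq_iff: "x \<in> F \<Longrightarrow> y \<in> F \<Longrightarrow> digits x = digits y \<longleftrightarrow> x = y"
  using sum_digits by metis

lemma digits_add:
  assumes "x \<in> F" "y \<in> F"
  shows "digits (x + y) = (digits x - digits y) \<union> (digits y - digits x)"
proof -
  have "x + y = (\<Sum>i\<in>(digits x - digits y) \<union> (digits y - digits x). \<alpha> i)"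
    using assms by (simp add: add_eq_sym_diff[symmetric] sum_digits)
  then show ?thesis
    using assms digits_subset by (simp add: digits_unique subset_iff)
qed

abbreviation N :: "(nat \<Rightarrow> int) monoid" where
  "N \<equiv> cyclic_power 4 t"

text \<open>With \<open>x\<close> read as the 0/1 vector of its basis coordinates, this is \<open>\<i>\<close> to the power \<open>n \<bullet> x\<close>.\<close>

definition phase :: "(nat \<Rightarrow> int) \<Rightarrow> 'a \<Rightarrow> complex" where
  "phase n x = \<i> powi (\<Sum>i\<in>digits x. n i)"

lemma phase_0 [simp]: "phase n 0 = 1"
  by (simp add: phase_def)

lemma phase_mult:
  assumes "x \<in> F"
  shows "phase (m \<otimes>\<^bsub>N\<^esub> n) x = phase m x * phase n x"
proof -
  have "(\<Sum>i\<in>digits x. (m \<otimes>\<^bsub>N\<^esub> n) i) = (\<Sum>i\<in>digits x. (m i + n i) mod 4)"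
    using digits_subset[OF assms] by (intro sum.cong) (auto simp: mult_cyclic_power)
  then have "phase (m \<otimes>\<^bsub>N\<^esub> n) x = \<i> powi (\<Sum>i\<in>digits x. (m i + n i) mod 4)"
    by (simp add: phase_def)
  also have "\<dots> = \<i> powi (\<Sum>i\<in>digits x. m i + n i)"
    by (metis i_powi_mod_4 mod_sum_eq)
  finally show ?thesis
    by (simp add: phase_def sum.distrib power_int_add)
qed

lemma phase_inv:
  assumes "x \<in> F" "n \<in> carrier N"
  shows "phase (inv\<^bsub>N\<^esub> n) x = cnj (phase n x)"
proof -
  have "(\<Sum>i\<in>digits x. (inv\<^bsub>N\<^esub> n) i) = (\<Sum>i\<in>digits x. (- n i) mod 4)"
    using digits_subset[OF assms(1)] assms(2) by (intro sum.cong) (auto simp: inv_cyclic_power)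
  then have "phase (inv\<^bsub>N\<^esub> n) x = \<i> powi (\<Sum>i\<in>digits x. (- n i) mod 4)"
    by (simp add: phase_def)
  also have "\<dots> = \<i> powi (\<Sum>i\<in>digits x. - n i)"
    by (metis i_powi_mod_4 mod_sum_eq)
  finally show ?thesis
    by (simp only: phase_def cnj_i_powi sum_negf)
qed

text \<open>A pair \<open>(x, z)\<close> stands for the vector with entries \<open>a + 2 b\<close>, where \<open>a\<close> and \<open>b\<close> are the
coordinates of \<open>x\<close> and \<open>z\<close>. Thus the pairs label the characters of \<open>C\<^sub>4\<^sup>t\<close>, and \<open>chi n w\<close> is the
value at \<open>n\<close> of the character labelled \<open>w\<close>.\<close>

definition chi :: "(nat \<Rightarrow> int) \<Rightarrow> 'a \<times> 'a \<Rightarrow> complex" where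
  "chi n = (\<lambda>(x, z). phase n x * (phase n z)\<^sup>2)"

lemma chi_0 [simp]: "chi n (0, 0) = 1"
  by (simp add: chi_def)

lemma chi_mult: "w \<in> F \<times> F \<Longrightarrow> chi (m \<otimes>\<^bsub>N\<^esub> n) w = chi m w * chi n w"
  by (auto simp: chi_def phase_mult power_mult_distrib)

lemma chi_inv: "w \<in> F \<times> F \<Longrightarrow> n \<in> carrier N \<Longrightarrow> chi (inv\<^bsub>N\<^esub> n) w = cnj (chi n w)"
  by (auto simp: chi_def phase_inv)

lemma chi_eq_powi:
  assumes "w \<in> F \<times> F"
  shows "chi n w = \<i> powi (\<Sum>i<t. n i * (of_bool (i \<in> digits (fst w)) + 2 * of_bool (i \<in> digits (snd w))))"
proof -
  have *: "(\<Sum>i\<in>digits x. n i) = (\<Sum>i<t. n i * of_bool (i \<in> digits x))" if "x \<in> F" for x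
    using digits_subset[OF that] by (intro sum.mono_neutral_cong_left) auto
  have "chi n w = \<i> powi ((\<Sum>i\<in>digits (fst w). n i) + 2 * (\<Sum>i\<in>digits (snd w). n i))"
    by (simp only: chi_def phase_def case_prod_beta power2_eq_square mult_2 i_powi_add)
  moreover have "fst w \<in> F" "snd w \<in> F" using assms by auto
  ultimately show ?thesis
    by (simp only: * sum_distrib_left sum.distrib distrib_left mult.left_commute[of 2])
qed

lemma chi_orthogonal:
  assumes "w \<in> F \<times> F" "w' \<in> F \<times> F"
  shows "(\<Sum>n\<in>carrier N. cnj (chi n w) * chi n w') = (if w = w' then 4 ^ t else 0)"
proof -
  define d :: "'a \<times> 'a \<Rightarrow> nat \<Rightarrow> int" where
    "d w i = of_bool (i \<in> digits (fst w)) + 2 * of_bool (i \<in> digits (snd w))" for w i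
  have "(\<Sum>n\<in>carrier N. cnj (chi n w) * chi n w') =
      (\<Sum>n\<in>carrier N. \<Prod>i<t. \<i> powi (n i * (d w' i - d w i)))"
  proof (rule sum.cong)
    fix n assume "n \<in> carrier N"
    have "cnj (chi n w) * chi n w' = \<i> powi ((\<Sum>i<t. n i * d w' i) - (\<Sum>i<t. n i * d w i))"
      using assms
      by (simp only: chi_eq_powi cnj_i_powi d_def diff_conv_add_uminus i_powi_add mult.commute)
    also have "(\<Sum>i<t. n i * d w' i) - (\<Sum>i<t. n i * d w i) = (\<Sum>i<t. n i * (d w' i - d w i))"
      by (simp add: sum_subtractf right_diff_distrib)
    also have "\<i> powi \<dots> = (\<Prod>i<t. \<i> powi (n i * (d w' i - d w i)))"
      by (induction t) (simp_all add: power_int_add)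
    finally show "cnj (chi n w) * chi n w' = \<dots>" .
  qed simp
  also have "\<dots> = (\<Prod>i<t. \<Sum>a\<in>{0..<4}. \<i> powi (a * (d w' i - d w i)))"
    \<comment> \<open>The sum factors over the coordinates. In each one, the digits differ by less than 4, so the
      sum of powers of \<open>\<i>\<close> vanishes unless they agree.\<close>
    by (simp add: carrier_cyclic_power prod_sum_PiE)
  also have "\<dots> = (\<Prod>i<t. if d w' i = d w i then 4 else 0)"
    by (intro prod.cong refl, subst sum_i_powi) (auto simp: d_def)
  also have "\<dots> = (if \<forall>i<t. d w' i = d w i then 4 ^ t else 0)"
    by auto
  also have "(\<forall>i<t. d w' i = d w i) \<longleftrightarrow> w = w'"
  proof
    assume eq: "\<forall>i<t. d w' i = d w i"
    have same: "(i \<in> digits (fst w) \<longleftrightarrow> i \<in> digits (fst w')) \<and> (i \<in> digits (snd w) \<longleftrightarrow> i \<in> digits (snd w'))"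
      if "i < t" for i
      using eq that by (auto simp: d_def of_bool_def split: if_splits)
    have F: "fst w \<in> F" "snd w \<in> F" "fst w' \<in> F" "snd w' \<in> F"
      using assms by auto
    then have "digits (fst w) = digits (fst w')" "digits (snd w) = digits (snd w')"
      using same digits_subset by (meson lessThan_iff subset_antisym subset_iff)+
    with F show "w = w'"
      by (simp add: digits_eq_iff prod_eq_iff)
  qed simp
  finally show ?thesis .
qed

lemma phase_power4: "phase n x ^ 4 = 1"
proof -
  have "phase n x ^ 4 = (\<i> ^ 4) powi (\<Sum>i\<in>digits x. n i)"
    unfolding phase_def by (metis power_int_commutes power_int_of_nat power_int_power mult.commute power_int_mult)
  then show ?thesis by (simp add: power_numeral_reduce)
qed

text \<open>Adding 0/1 vectors in \<open>F\<close> drops the carries. A carry occurs where both vectors have a 1, and it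
contributes \<open>\<i>\<^sup>2\<close> to the corresponding power of the \<open>n\<close>-entry, so \<open>phase n\<close> is multiplicative up to
a sign.\<close>

lemma phase_times_phase:
  assumes "x \<in> F" "y \<in> F"
  shows "\<exists>u\<in>F. phase n x * phase n y = phase n (x + y) * (phase n u)\<^sup>2"
proof -
  define s :: "nat set \<Rightarrow> int" where "s A = (\<Sum>i\<in>A. n i)" for A
  let ?A = "digits x" and ?B = "digits y"
  define u where "u = (\<Sum>i\<in>?A \<inter> ?B. \<alpha> i)"
  have sub: "?A \<inter> ?B \<subseteq> {..<t}" using assms digits_subset by blast
  then have u: "u \<in> F" "digits u = ?A \<inter> ?B"
    using bij_betwE[OF basis] by (auto simp: u_def digits_unique)
  have "s ?A = s (?A \<inter> ?B) + s (?A - ?B)" "s ?B = s (?A \<inter> ?B) + s (?B - ?A)"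
    unfolding s_def using assms sum.Int_Diff finite_digits by (metis, metis Int_commute)
  moreover have "s (digits (x + y)) = s (?A - ?B) + s (?B - ?A)"
    unfolding s_def digits_add[OF assms] using assms by (intro sum.union_disjoint) auto
  ultimately have "s ?A + s ?B = s (digits (x + y)) + (s (digits u) + s (digits u))"
    by (simp add: u)
  then have "\<i> powi (s ?A + s ?B) = \<i> powi (s (digits (x + y)) + (s (digits u) + s (digits u)))"
    by simp
  then have "phase n x * phase n y = phase n (x + y) * (phase n u)\<^sup>2"
    by (simp only: phase_def s_def i_powi_add power2_eq_square)
  with u show ?thesis by blast
qed

lemma phase_square_add:
  assumes "x \<in> F" "y \<in> F"
  shows "(phase n (x + y))\<^sup>2 = (phase n x)\<^sup>2 * (phase n y)\<^sup>2"
proof -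
  obtain u where "phase n x * phase n y = phase n (x + y) * (phase n u)\<^sup>2"
    using phase_times_phase[OF assms] by blast
  then have "(phase n x * phase n y)\<^sup>2 = (phase n (x + y))\<^sup>2 * phase n u ^ 4"
    by (simp add: power_mult_distrib)
  then show ?thesis by (simp add: phase_power4 power_mult_distrib)
qed

text \<open>The square of \<open>phase n\<close> forgets the carries and is an additive character of \<open>F\<close>. The
element \<open>c\<close> representing it is what links the group \<open>C\<^sub>4\<^sup>t\<close> to the multiplication of \<open>F\<close>.\<close>

lemma phase_square_is_psi: "\<exists>c\<in>F. \<forall>x\<in>F. (phase n x)\<^sup>2 = psi (c * x)"
  using phase_square_add by (intro character_is_psi) auto

section \<open>A linear family of bent functions\<close>

text \<open>The Fourier transform of the function \<open>w \<mapsto> psi (y * f w)\<close> on the characters of \<open>C\<^sub>4\<^sup>t\<close>, where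
\<open>f (x, z) = z + z\<^sup>2 / x\<close>, read as \<open>z\<close> for \<open>x = 0\<close>. Two properties of \<open>f\<close> matter:
\<open>psi (y * f w)\<close> is an additive character in \<open>y\<close>, and for \<open>y \<noteq> 0\<close> it is bent in \<open>w\<close>, that is, its transform has
constant modulus.\<close>

definition transform :: "(nat \<Rightarrow> int) \<Rightarrow> 'a \<Rightarrow> complex" where
  "transform n y = (\<Sum>(x, z)\<in>F \<times> F. psi (y * (z + z\<^sup>2 / x)) * chi n (x, z))"

text \<open>For fixed \<open>x\<close> the sum over \<open>z\<close> is a character sum. It vanishes unless \<open>(y + c)\<^sup>2 = y / x\<close>, which
singles out one value of \<open>x\<close>. In the case \<open>y = c\<close> this value is \<open>0\<close>, in accordance with the
convention \<open>y / 0 = 0\<close>.\<close>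

lemma transform_eq_phase:
  assumes "y \<in> F" "y \<noteq> 0" "c \<in> F" and c: "\<And>x. x \<in> F \<Longrightarrow> (phase n x)\<^sup>2 = psi (c * x)"
  shows "transform n y = 2 ^ t * phase n (y / (y + c)\<^sup>2)"
proof -
  have "transform n y = (\<Sum>x\<in>F. \<Sum>z\<in>F. psi (y * (z + z\<^sup>2 / x)) * chi n (x, z))"
    by (simp add: transform_def sum.cartesian_product)
  also have "\<dots> = (\<Sum>x\<in>F. phase n x * (\<Sum>z\<in>F. psi (((y + c)\<^sup>2 + y / x) * z\<^sup>2)))"
  proof (intro sum.cong refl, unfold sum_distrib_left, intro sum.cong refl)
    fix x z assume xz: "x \<in> F" "z \<in> F"
    have "psi (((y + c)\<^sup>2 + y / x) * z\<^sup>2) = psi (((y + c) * z)\<^sup>2 + y * (z\<^sup>2 / x))"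
      by (subst distrib_right) (simp add: power_mult_distrib)
    also have "\<dots> = psi ((y + c) * z) * psi (y * (z\<^sup>2 / x))"
      using xz assms by (subst psi_add) (auto simp: psi_square)
    also have "\<dots> = psi (y * (z + z\<^sup>2 / x)) * psi (c * z)"
      using xz assms by (simp add: ring_distribs psi_add)
    finally show "psi (y * (z + z\<^sup>2 / x)) * chi n (x, z) =
        phase n x * psi (((y + c)\<^sup>2 + y / x) * z\<^sup>2)"
      using xz by (simp add: chi_def c)
  qed
  also have "\<dots> = (\<Sum>x\<in>F. if x = y / (y + c)\<^sup>2 then phase n x * 2 ^ t else 0)"
  proof (intro sum.cong refl)
    fix x assume x: "x \<in> F"
    have "bij_betw (\<lambda>z. z\<^sup>2) F F"
      by (intro bij_betw_imageI endo_inj_surj) (auto simp: inj_on_def power2_eq_iff)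
    then have "(\<Sum>z\<in>F. psi (((y + c)\<^sup>2 + y / x) * z\<^sup>2)) = (\<Sum>z\<in>F. psi (((y + c)\<^sup>2 + y / x) * z))"
      by (rule sum.reindex_bij_betw)
    also have "\<dots> = (if (y + c)\<^sup>2 + y / x = 0 then 2 ^ t else 0)"
      using x assms by (intro sum_psi) simp
    also have "(y + c)\<^sup>2 + y / x = 0 \<longleftrightarrow> x = y / (y + c)\<^sup>2"
      using \<open>y \<noteq> 0\<close> by (auto simp: add_eq_0_iff_eq)
    finally show "phase n x * (\<Sum>z\<in>F. psi (((y + c)\<^sup>2 + y / x) * z\<^sup>2)) =
        (if x = y / (y + c)\<^sup>2 then phase n x * 2 ^ t else 0)" by simp
  qed
  also have "\<dots> = 2 ^ t * phase n (y / (y + c)\<^sup>2)"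
    using assms by simp
  finally show ?thesis .
qed

text \<open>At the surviving point \<open>x = y / (y + c)\<^sup>2\<close> the phase could a priori be \<open>\<plusminus> \<i>\<close>. Its square is
\<open>psi (c * x)\<close>, and with \<open>p = y / (y + c)\<close> one has \<open>c * x = p + p\<^sup>2\<close>, an element of trace zero. So the
phase is real.\<close>

lemma transform_nonzero:
  assumes "y \<in> F" "y \<noteq> 0"
  shows "transform n y \<in> {2 ^ t, - (2 ^ t)}"
proof -
  obtain c where c: "c \<in> F" "\<And>x. x \<in> F \<Longrightarrow> (phase n x)\<^sup>2 = psi (c * x)"
    using phase_square_is_psi by blast
  define p where "p = y / (y + c)"
  have "p \<in> F" using assms c by (simp add: p_def)
  have "c * (y / (y + c)\<^sup>2) = p + p\<^sup>2"
  proof (cases "y = c")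
    case False
    define s where "s = y + c"
    have "s \<noteq> 0" using False by (simp add: s_def add_eq_0_iff_eq)
    then have "(s + y) * (y / s\<^sup>2) = y / s + (y / s)\<^sup>2"
      by (simp add: power2_eq_square distrib_right add_divide_distrib)
    moreover have "s + y = c" unfolding s_def by (metis add.commute add_left_self)
    ultimately show ?thesis unfolding p_def s_def[symmetric] by simp
  qed (simp add: p_def)
  then have "psi (c * (y / (y + c)\<^sup>2)) = 1"
    using \<open>p \<in> F\<close> by (simp add: psi_add psi_square)
  then have "(phase n (y / (y + c)\<^sup>2))\<^sup>2 = 1"
    using assms c by simp
  then have "phase n (y / (y + c)\<^sup>2) = 1 \<or> phase n (y / (y + c)\<^sup>2) = - 1"
    by (simp add: power2_eq_1_iff)
  then show ?thesis
    using transform_eq_phase[OF assms c] by auto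
qed

text \<open>Orthogonality on the other side: the sum of all \<open>chi n w\<close> over \<open>w\<close>. If \<open>(phase n)\<^sup>2\<close> is trivial,
then \<open>phase n\<close> is itself an additive character of \<open>F\<close>; so one of the two factors vanishes unless \<open>n\<close> is
the identity.\<close>

lemma transform_zero:
  assumes "n \<in> carrier N"
  shows "transform n 0 = (if n = \<one>\<^bsub>N\<^esub> then 4 ^ t else 0)"
proof (cases "n = \<one>\<^bsub>N\<^esub>")
  case True
  have "(\<Sum>i\<in>digits x. n i) = 0" if "x \<in> F" for x
    using digits_subset[OF that] True by (intro sum.neutral) (auto simp: one_cyclic_power)
  then have "chi n w = 1" if "w \<in> F \<times> F" for w
    using that by (auto simp: chi_def phase_def)
  then have "transform n 0 = (\<Sum>w\<in>F \<times> F. 1)"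
    unfolding transform_def by (intro sum.cong) auto
  also have "\<dots> = 4 ^ t"
    by (simp add: card_cartesian_product card_F flip: power_mult_distrib)
  finally show ?thesis using True by simp
next
  case False
  have "\<not> ((\<forall>z\<in>F. (phase n z)\<^sup>2 = 1) \<and> (\<forall>x\<in>F. phase n x = 1))"
  proof
    assume *: "(\<forall>z\<in>F. (phase n z)\<^sup>2 = 1) \<and> (\<forall>x\<in>F. phase n x = 1)"
    have "n i = 0" if "i < t" for i
    proof -
      have "\<alpha> i \<in> F" "digits (\<alpha> i) = {i}"
        using bij_betwE[OF basis] digits_unique[of "{i}"] that by (force, simp)
      then have "\<i> powi (n i) = 1"
        using * by (metis phase_def sum.insert sum.empty finite.emptyI empty_iff add_0_right)
      moreover have "n i \<in> {0..<4}"
        using assms that by (simp add: carrier_cyclic_power PiE_iff)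
      then have "n i = 0 \<or> n i = 1 \<or> n i = 2 \<or> n i = 3" by auto
      ultimately show ?thesis by (auto simp: power_int_def power_numeral_reduce complex_eq_iff)
    qed
    then have "n = \<one>\<^bsub>N\<^esub>"
      using assms by (auto simp: one_cyclic_power carrier_cyclic_power PiE_def extensional_def)
    with False show False ..
  qed
  moreover have "(\<Sum>x\<in>F. phase n x) = 0"
    if "\<forall>z\<in>F. (phase n z)\<^sup>2 = 1" "\<not> (\<forall>x\<in>F. phase n x = 1)"
  proof -
    have "phase n (x + y) = phase n x * phase n y" if "x \<in> F" "y \<in> F" for x y
      using phase_times_phase[OF that, of n] \<open>\<forall>z\<in>F. (phase n z)\<^sup>2 = 1\<close> by auto
    from sum_character[of "phase n", OF this] that show ?thesis by auto
  qed
  moreover have "(\<Sum>z\<in>F. (phase n z)\<^sup>2) = 0" if "\<not> (\<forall>z\<in>F. (phase n z)\<^sup>2 = 1)"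
    using sum_character[of "\<lambda>z. (phase n z)\<^sup>2", OF phase_square_add] that by auto
  moreover have "transform n 0 = (\<Sum>x\<in>F. phase n x) * (\<Sum>z\<in>F. (phase n z)\<^sup>2)"
    by (simp add: transform_def chi_def sum_product sum.cartesian_product)
  ultimately show ?thesis using False by auto
qed

lemma transform_inv:
  assumes "n \<in> carrier N"
  shows "transform (inv\<^bsub>N\<^esub> n) y = cnj (transform n y)"
proof -
  have *: "psi (y * (z + z\<^sup>2 / x)) * chi (inv\<^bsub>N\<^esub> n) (x, z) = cnj (psi (y * (z + z\<^sup>2 / x)) * chi n (x, z))"
    if "x \<in> F" "z \<in> F" for x z
    using chi_inv[of "(x, z)" n] assms that by (simp only: mem_Sigma_iff complex_cnj_mult cnj_psi)
  have "cnj (transform n y) = (\<Sum>w\<in>F \<times> F. cnj (case w of (x, z) \<Rightarrow> psi (y * (z + z\<^sup>2 / x)) * chi n (x, z)))"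
    by (simp only: transform_def cnj_sum)
  also have "\<dots> = transform (inv\<^bsub>N\<^esub> n) y"
    unfolding transform_def by (intro sum.cong refl) (auto simp only: prod.case *)
  finally show ?thesis ..
qed

lemma sum_transform: 
  assumes "y \<in> F"
  shows "(\<Sum>n\<in>carrier N. transform n y) = 4 ^ t"
proof -
  have "(\<Sum>n\<in>carrier N. transform n y) =
      (\<Sum>(x, z)\<in>F \<times> F. psi (y * (z + z\<^sup>2 / x)) * (\<Sum>n\<in>carrier N. cnj (chi n (0, 0)) * chi n (x, z)))"
    unfolding transform_def by (subst sum.swap) (simp add: sum_distrib_left case_prod_beta)
  also have "\<dots> = (\<Sum>w\<in>F \<times> F. if w = (0, 0) then 4 ^ t else 0)"
    by (intro sum.cong refl, clarify, subst chi_orthogonal) auto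
  finally show ?thesis by simp
qed

text \<open>By orthogonality only the diagonal terms \<open>psi (y * f w) * psi ((y + b) * f w)\<close> survive, and they
equal \<open>psi (b * f w)\<close>: the shift \<open>y\<close> cancels because the factors are additive characters in \<open>y\<close> with values \<open>\<plusminus> 1\<close>.\<close>

lemma transform_correlation:
  assumes "y \<in> F" "b \<in> F"
  shows "(\<Sum>n\<in>carrier N. cnj (transform n y) * transform (m \<otimes>\<^bsub>N\<^esub> n) (y + b)) = 4 ^ t * transform m b"
proof -
  define f where "f = (\<lambda>(x, z). z + z\<^sup>2 / x :: 'a)"
  have f: "f w \<in> F" if "w \<in> F \<times> F" for w
    using that by (cases w) (simp add: f_def)
  have tr: "transform n y = (\<Sum>w\<in>F \<times> F. psi (y * f w) * chi n w)" for n y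
    by (simp add: transform_def f_def case_prod_beta)
  have "(\<Sum>n\<in>carrier N. cnj (transform n y) * transform (m \<otimes>\<^bsub>N\<^esub> n) (y + b)) =
     (\<Sum>n\<in>carrier N. \<Sum>w\<in>F \<times> F. \<Sum>w'\<in>F \<times> F.
        psi (y * f w) * psi ((y + b) * f w') * chi m w' * (cnj (chi n w) * chi n w'))"
    unfolding tr cnj_sum sum_product
    by (intro sum.cong refl) (simp add: chi_mult mult_ac)
  also have "\<dots> = (\<Sum>w\<in>F \<times> F. \<Sum>w'\<in>F \<times> F. \<Sum>n\<in>carrier N. 
        psi (y * f w) * psi ((y + b) * f w') * chi m w' * (cnj (chi n w) * chi n w'))"
    by (subst sum.swap, intro sum.cong refl, rule sum.swap)
  also have "\<dots> = (\<Sum>w\<in>F \<times> F. \<Sum>w'\<in>F \<times> F.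
        if w = w' then psi (y * f w) * psi ((y + b) * f w') * chi m w' * 4 ^ t else 0)"
    by (intro sum.cong refl) (simp only: sum_distrib_left[symmetric] chi_orthogonal, simp)
  also have "\<dots> = (\<Sum>w\<in>F \<times> F. psi (y * f w) * psi ((y + b) * f w) * chi m w * 4 ^ t)"
    by (intro sum.cong refl) simp
  also have "\<dots> = 4 ^ t * transform m b"
    unfolding tr sum_distrib_left
  proof (intro sum.cong refl)
    fix w assume w: "w \<in> F \<times> F"
    have "psi (y * f w) * psi ((y + b) * f w) = psi (b * f w)"
      using assms f[OF w] by (simp add: ring_distribs psi_add flip: mult.assoc)
    then show "psi (y * f w) * psi ((y + b) * f w) * chi m w * 4 ^ t = 4 ^ t * (psi (b * f w) * chi m w)"
      by simp
  qed
  finally show ?thesis .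
qed

text \<open>For \<open>y \<noteq> 0\<close> this is a sign, by \<open>transform_nonzero\<close>. The elements \<open>n\<close> of sign \<open>-1\<close> form the block
over \<open>y\<close> of the partial difference set.\<close>

definition dual_sign :: "(nat \<Rightarrow> int) \<Rightarrow> 'a \<Rightarrow> real" where
  "dual_sign n y = Re (transform n y) / 2 ^ t"

lemma four_power: "(4::'b::comm_semiring_1) ^ t = 2 ^ t * 2 ^ t"
  by (simp flip: power_mult_distrib)

lemma transform_eq_dual_sign:
  assumes "n \<in> carrier N" "y \<in> F"
  shows "transform n y = of_real (2 ^ t * dual_sign n y)"
proof -
  have "transform n y \<in> \<real>"
    using transform_nonzero[OF assms(2), of n] transform_zero[OF assms(1)]
    by (cases "y = 0") auto
  then show ?thesis
    by (simp add: dual_sign_def of_real_Re flip: of_real_mult)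
qed

lemma dual_sign_nonzero: "y \<in> F \<Longrightarrow> y \<noteq> 0 \<Longrightarrow> dual_sign n y = 1 \<or> dual_sign n y = - 1"
  using transform_nonzero[of y n] by (auto simp: dual_sign_def)

lemma dual_sign_zero: "n \<in> carrier N \<Longrightarrow> n \<noteq> \<one>\<^bsub>N\<^esub> \<Longrightarrow> dual_sign n 0 = 0"
  by (simp add: dual_sign_def transform_zero)

text \<open>Inversion conjugates the transform, which is real; so each block is closed under inversion. This is
what allows a twist of the group law by inversion.\<close>

lemma dual_sign_inv: "n \<in> carrier N \<Longrightarrow> dual_sign (inv\<^bsub>N\<^esub> n) y = dual_sign n y"
  by (simp add: dual_sign_def transform_inv)

lemma sum_dual_sign:
  assumes "y \<in> F"
  shows "(\<Sum>n\<in>carrier N. dual_sign n y) = 2 ^ t"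
proof -
  have "complex_of_real (2 ^ t * (\<Sum>n\<in>carrier N. dual_sign n y)) = (\<Sum>n\<in>carrier N. transform n y)"
    unfolding sum_distrib_left of_real_sum using assms
    by (intro sum.cong refl) (simp only: transform_eq_dual_sign)
  also have "\<dots> = of_real (2 ^ t * 2 ^ t)"
    by (simp only: sum_transform[OF assms] four_power of_real_mult of_real_power of_real_numeral)
  finally have "2 ^ t * (\<Sum>n\<in>carrier N. dual_sign n y) = 2 ^ t * 2 ^ t"
    by (simp only: of_real_eq_iff)
  then show ?thesis by simp
qed

text \<open>The identity that carries the construction: the correlation of the signs over \<open>y\<close> with those over
\<open>y + b\<close> does not depend on \<open>y\<close>.\<close>

lemma dual_sign_correlation:
  assumes "y \<in> F" "b \<in> F" "m \<in> carrier N"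
  shows "(\<Sum>n\<in>carrier N. dual_sign n y * dual_sign (m \<otimes>\<^bsub>N\<^esub> n) (y + b)) = 2 ^ t * dual_sign m b"
proof -
  interpret N: group N by (rule group_cyclic_power)
  have "complex_of_real (4 ^ t * (\<Sum>n\<in>carrier N. dual_sign n y * dual_sign (m \<otimes>\<^bsub>N\<^esub> n) (y + b))) =
    (\<Sum>n\<in>carrier N. cnj (transform n y) * transform (m \<otimes>\<^bsub>N\<^esub> n) (y + b))"
    unfolding sum_distrib_left of_real_sum using assms
    by (intro sum.cong) (auto simp: transform_eq_dual_sign four_power)
  also have "\<dots> = of_real (4 ^ t * (2 ^ t * dual_sign m b))"
    by (simp only: transform_correlation[OF assms(1,2)] transform_eq_dual_sign[OF assms(3,2)]
        of_real_mult of_real_power of_real_numeral)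
  finally show ?thesis by (simp only: of_real_eq_iff) simp
qed

end

section \<open>Counting differences in a group twisted by inversion\<close>

lemma comm_group_cyclic_power: "comm_group (cyclic_power n m)"
  by (intro group.group_comm_groupI group_cyclic_power) (simp add: mult_cyclic_power add.commute)

lemma (in group) card_difference_pairs:
  assumes "D \<subseteq> carrier G" "g \<in> carrier G"
  shows "card {(d1, d2). d1 \<in> D \<and> d2 \<in> D \<and> g = d1 \<otimes> inv d2} = card {d \<in> D. g \<otimes> d \<in> D}"
proof -
  have eq: "g = d1 \<otimes> inv d2 \<longleftrightarrow> d1 = g \<otimes> d2" if "d1 \<in> D" "d2 \<in> D" for d1 d2
    using that assms inv_solve_right[of g d1 d2] by blast
  have "{(d1, d2). d1 \<in> D \<and> d2 \<in> D \<and> g = d1 \<otimes> inv d2} =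
      {(d1, d2). d1 \<in> D \<and> d2 \<in> D \<and> d1 = g \<otimes> d2}"
    by (simp add: eq cong: conj_cong)
  also have "\<dots> = (\<lambda>d. (g \<otimes> d, d)) ` {d \<in> D. g \<otimes> d \<in> D}"
    by auto
  finally show ?thesis by (simp add: card_image inj_on_def)
qed

context binary_field_basis
begin

text \<open>There is no block over \<open>y = 0\<close>, where \<open>dual_sign\<close> takes other values than signs.\<close>

definition block_ind :: "(nat \<Rightarrow> int) \<Rightarrow> 'a \<Rightarrow> real" where
  "block_ind n y = (if y = 0 then 0 else (1 - dual_sign n y) / 2)"

lemma block_ind_eq_of_bool: "y \<in> F \<Longrightarrow> block_ind n y = of_bool (y \<noteq> 0 \<and> dual_sign n y = - 1)"
  using dual_sign_nonzero[of y n] by (auto simp: block_ind_def)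

lemma block_ind_inv: "n \<in> carrier N \<Longrightarrow> block_ind (inv\<^bsub>N\<^esub> n) y = block_ind n y"
  by (simp add: block_ind_def dual_sign_inv)

lemma card_N: "real (card (carrier N)) = 2 ^ t * 2 ^ t"
  by (simp add: card_cyclic_power four_power)

lemma sum_block_ind: "(\<Sum>n\<in>carrier N. \<Sum>y\<in>F. block_ind n y) = (2 ^ t - 1) * (2 ^ t * 2 ^ t - 2 ^ t) / 2"
proof -
  have "(\<Sum>n\<in>carrier N. \<Sum>y\<in>F. block_ind n y) = (\<Sum>y\<in>F. \<Sum>n\<in>carrier N. block_ind n y)"
    by (rule sum.swap)
  also have "\<dots> = (\<Sum>y\<in>F - {0}. (2 ^ t * 2 ^ t - 2 ^ t) / 2)"
    by (intro sum.mono_neutral_cong_right)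
       (auto simp: block_ind_def sum_subtractf sum_dual_sign card_N simp flip: sum_divide_distrib)
  finally show ?thesis by (simp add: card_F)
qed

lemma sum_block_ind_shift:
  assumes "y \<in> F" "b \<in> F" "m \<in> carrier N" "y \<noteq> 0" "y \<noteq> b"
  shows "(\<Sum>n\<in>carrier N. block_ind n y * block_ind (m \<otimes>\<^bsub>N\<^esub> n) (b + y)) =
    2 ^ t * (2 ^ t - 2 + dual_sign m b) / 4"
proof -
  interpret N: comm_group N by (rule comm_group_cyclic_power)
  have nz: "b + y \<noteq> 0" using assms by (simp add: add_eq_0_iff_eq)
  have shift: "(\<Sum>n\<in>carrier N. dual_sign (m \<otimes>\<^bsub>N\<^esub> n) (b + y)) = (\<Sum>n\<in>carrier N. dual_sign n (b + y))"
    using assms(3)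
    by (intro sum.reindex_bij_witness[of _ "\<lambda>n. inv\<^bsub>N\<^esub> m \<otimes>\<^bsub>N\<^esub> n" "\<lambda>n. m \<otimes>\<^bsub>N\<^esub> n"])
       (simp_all add: N.inv_solve_left N.m_assoc[symmetric])
  have block_ind_mult: "block_ind n y * block_ind (m \<otimes>\<^bsub>N\<^esub> n) (b + y) =
      (1 - dual_sign n y - dual_sign (m \<otimes>\<^bsub>N\<^esub> n) (b + y) + dual_sign n y * dual_sign (m \<otimes>\<^bsub>N\<^esub> n) (y + b)) / 4" for n
    using assms nz unfolding block_ind_def add.commute[of b y] by (simp add: field_simps)
  have "(\<Sum>n\<in>carrier N. block_ind n y * block_ind (m \<otimes>\<^bsub>N\<^esub> n) (b + y)) =
      (2 ^ t * 2 ^ t - 2 ^ t - 2 ^ t + 2 ^ t * dual_sign m b) / 4"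
    unfolding block_ind_mult sum_divide_distrib[symmetric] sum.distrib sum_subtractf
    using assms by (simp add: shift sum_dual_sign card_N dual_sign_correlation)
  then show ?thesis by (simp add: algebra_simps)
qed

lemma block_ind_correlation:
  assumes "b \<in> F" "m \<in> carrier N"
  shows "(\<Sum>n\<in>carrier N. \<Sum>y\<in>F. block_ind n y * block_ind (m \<otimes>\<^bsub>N\<^esub> n) (b + y)) =
    (if b = 0 then 2 ^ t - 1 else 2 ^ t - 2) * (2 ^ t * (2 ^ t - 2 + dual_sign m b) / 4)"
proof -
  have "(\<Sum>n\<in>carrier N. \<Sum>y\<in>F. block_ind n y * block_ind (m \<otimes>\<^bsub>N\<^esub> n) (b + y)) =
      (\<Sum>y\<in>F. \<Sum>n\<in>carrier N. block_ind n y * block_ind (m \<otimes>\<^bsub>N\<^esub> n) (b + y))"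
    by (rule sum.swap)
  also have "\<dots> = (\<Sum>y\<in>F - {0, b}. 2 ^ t * (2 ^ t - 2 + dual_sign m b) / 4)"
    using assms sum_block_ind_shift by (intro sum.mono_neutral_cong_right) (auto simp: block_ind_def)
  also have "\<dots> = real (card (F - {0, b})) * (2 ^ t * (2 ^ t - 2 + dual_sign m b) / 4)"
    by simp
  also have "real (card (F - {0, b})) = (if b = 0 then 2 ^ t - 1 else 2 ^ t - 2)"
  proof -
    have "card {0, b} \<le> card F" using assms by (intro card_mono) auto
    then show ?thesis using assms by (auto simp: card_Diff_subset card_F)
  qed
  finally show ?thesis .
qed

text \<open>A group in bijection with \<open>C\<^sub>4\<^sup>t \<times> F\<close> whose product agrees with that of the direct product up to
inverting the second factor in \<open>C\<^sub>4\<^sup>t\<close>, as dictated by the left-hand element. The representations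
\<open>g = d\<^sub>1 d\<^sub>2\<^sup>-\<^sup>1\<close> correspond to the \<open>d\<close> with \<open>d\<close> and \<open>g d\<close> both in the set. As the blocks are closed
under inversion, the substitution \<open>n \<mapsto> n\<^sup>-\<^sup>1\<close> removes the twist from the count, which then is the
autocorrelation of the block indicator in the direct product.\<close>

lemma partial_difference_set_of_twisted_product:
  fixes G :: "('g, 'r) monoid_scheme" and \<nu> :: "'g \<Rightarrow> nat \<Rightarrow> int" and \<eta> :: "'g \<Rightarrow> 'a"
  assumes "group G"
    and bij: "bij_betw (\<lambda>g. (\<nu> g, \<eta> g)) (carrier G) (carrier N \<times> F)"
    and \<eta>: "\<And>g h. g \<in> carrier G \<Longrightarrow> h \<in> carrier G \<Longrightarrow> \<eta> (g \<otimes>\<^bsub>G\<^esub> h) = \<eta> g + \<eta> h"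
    and \<nu>: "\<And>g. g \<in> carrier G \<Longrightarrow>
      (\<forall>h\<in>carrier G. \<nu> (g \<otimes>\<^bsub>G\<^esub> h) = \<nu> g \<otimes>\<^bsub>N\<^esub> \<nu> h) \<or>
      (\<forall>h\<in>carrier G. \<nu> (g \<otimes>\<^bsub>G\<^esub> h) = \<nu> g \<otimes>\<^bsub>N\<^esub> inv\<^bsub>N\<^esub> \<nu> h)"
    and "t \<ge> 2"
  shows "partial_difference_set G {g \<in> carrier G. \<eta> g \<noteq> 0 \<and> dual_sign (\<nu> g) (\<eta> g) = - 1}
    (2 ^ (3 * t))
    ((2 ^ (2 * t - 1) - 2 ^ (t - 1)) * (2 ^ t - 1))
    (2 ^ (t - 1) + (2 ^ (2 * t - 1) - 2 ^ (t - 1)) * (2 ^ (t - 1) - 2))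
    ((2 ^ (2 * t - 1) - 2 ^ (t - 1)) * (2 ^ (t - 1) - 1))"
    (is "partial_difference_set G ?D _ _ _ _")
proof -
  interpret group G by fact
  define D where "D = ?D"
  have mem_D: "g \<in> D \<longleftrightarrow> g \<in> carrier G \<and> \<eta> g \<noteq> 0 \<and> dual_sign (\<nu> g) (\<eta> g) = - 1" for g
    by (simp add: D_def)
  have D_subset: "D \<subseteq> carrier G" by (auto simp: mem_D)
  interpret N: comm_group N by (rule comm_group_cyclic_power)
  \<comment> \<open>All parameters are polynomials in half the field order.\<close>
  define u :: nat where "u = 2 ^ (t - 1)"
  have pow: "2 ^ t = 2 * u" "2 ^ (2 * t - 1) = 2 * u\<^sup>2"
    using t_pos by (cases t; simp add: u_def power_even_eq)+
  have powR: "2 ^ t = 2 * real u"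
    using arg_cong[OF pow(1), of real] by simp
  have u: "u \<ge> 2" unfolding u_def using \<open>t \<ge> 2\<close> self_le_power[of "2::nat" "t - 1"] by simp
  have real_diffs: "real (2 * u\<^sup>2 - u) = 2 * real u * real u - real u"
      "real (2 * u - 1) = 2 * real u - 1" "real (u - 1) = real u - 1" "real (u - 2) = real u - 2"
    using u by (simp_all add: of_nat_diff power2_eq_square)

  have [simp]: "\<nu> g \<in> carrier N" "\<eta> g \<in> F" if "g \<in> carrier G" for g
    using bij_betwE[OF bij] that by auto
  have fin: "finite (carrier G)"
    using bij_betw_finite[OF bij] finite_cyclic_power[of 4 t] by simp
  have inj: "g = h" if "g \<in> carrier G" "h \<in> carrier G" "\<nu> g = \<nu> h" "\<eta> g = \<eta> h" for g h
    using bij that by (auto simp: bij_betw_def inj_on_def)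
  have \<eta>_one: "\<eta> \<one>\<^bsub>G\<^esub> = 0"
    using \<eta>[of "\<one>\<^bsub>G\<^esub>" "\<one>\<^bsub>G\<^esub>"] by simp
  have \<nu>_one: "\<nu> \<one>\<^bsub>G\<^esub> = \<one>\<^bsub>N\<^esub>"
  proof -
    have mem: "\<nu> \<one>\<^bsub>G\<^esub> \<in> carrier N" by simp
    have "\<nu> \<one>\<^bsub>G\<^esub> = \<nu> \<one>\<^bsub>G\<^esub> \<otimes>\<^bsub>N\<^esub> \<nu> \<one>\<^bsub>G\<^esub> \<or> \<nu> \<one>\<^bsub>G\<^esub> = \<nu> \<one>\<^bsub>G\<^esub> \<otimes>\<^bsub>N\<^esub> inv\<^bsub>N\<^esub> \<nu> \<one>\<^bsub>G\<^esub>"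
      using \<nu>[OF one_closed] one_closed r_one[OF one_closed] by metis
    then show ?thesis
      using N.r_cancel_one'[OF mem mem] N.r_inv[OF mem] by metis
  qed
  have sum_G: "(\<Sum>g\<in>carrier G. f (\<nu> g) (\<eta> g)) = (\<Sum>n\<in>carrier N. \<Sum>y\<in>F. f n y)" for f :: "_ \<Rightarrow> _ \<Rightarrow> real"
    using sum.reindex_bij_betw[OF bij, of "\<lambda>(n, y). f n y"] by (simp add: sum.cartesian_product)
  have card_eq_sum: "real (card {g \<in> carrier G. P g}) = (\<Sum>g\<in>carrier G. of_bool (P g))" for P
    using fin by (simp add: Int_def)

  have "Coset.order G = card (carrier N) * card F"
    using bij_betw_same_card[OF bij] by (simp add: Coset.order_def card_cartesian_product)
  also have "\<dots> = 2 ^ (3 * t)"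
    by (simp add: card_cyclic_power card_F four_power flip: power_add)
  finally have order: "Coset.order G = 2 ^ (3 * t)" .

  have "real (card {g \<in> carrier G. g \<in> D}) = (\<Sum>g\<in>carrier G. block_ind (\<nu> g) (\<eta> g))"
    unfolding card_eq_sum by (intro sum.cong) (auto simp: block_ind_eq_of_bool mem_D)
  also have "\<dots> = real ((2 * u\<^sup>2 - u) * (2 * u - 1))"
    unfolding sum_G sum_block_ind powR of_nat_mult real_diffs by (simp add: field_simps)
  finally have card_D: "card D = (2 * u\<^sup>2 - u) * (2 * u - 1)"
    unfolding of_nat_eq_iff using D_subset by (simp add: Collect_conj_eq Int_absorb1)

  have count: "real (card {(d1, d2). d1 \<in> D \<and> d2 \<in> D \<and> g = d1 \<otimes>\<^bsub>G\<^esub> inv\<^bsub>G\<^esub> d2}) =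
      (if \<eta> g = 0 then 2 * u - 1 else 2 * u - 2) * (2 * u * (2 * u - 2 + dual_sign (\<nu> g) (\<eta> g)) / 4)"
    if g: "g \<in> carrier G" for g
  proof -
    have "card {(d1, d2). d1 \<in> D \<and> d2 \<in> D \<and> g = d1 \<otimes>\<^bsub>G\<^esub> inv\<^bsub>G\<^esub> d2} =
        card {d \<in> D. g \<otimes>\<^bsub>G\<^esub> d \<in> D}"
      using D_subset g by (rule card_difference_pairs)
    also have "{d \<in> D. g \<otimes>\<^bsub>G\<^esub> d \<in> D} = {d \<in> carrier G. d \<in> D \<and> g \<otimes>\<^bsub>G\<^esub> d \<in> D}"
      using D_subset by blast
    finally have "real (card {(d1, d2). d1 \<in> D \<and> d2 \<in> D \<and> g = d1 \<otimes>\<^bsub>G\<^esub> inv\<^bsub>G\<^esub> d2}) =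
        real (card {d \<in> carrier G. d \<in> D \<and> g \<otimes>\<^bsub>G\<^esub> d \<in> D})"
      by (simp only:)
    also have "\<dots> = (\<Sum>d\<in>carrier G. block_ind (\<nu> d) (\<eta> d) * block_ind (\<nu> (g \<otimes>\<^bsub>G\<^esub> d)) (\<eta> (g \<otimes>\<^bsub>G\<^esub> d)))"
      unfolding card_eq_sum using g by (intro sum.cong) (auto simp: block_ind_eq_of_bool mem_D)
    also have "\<dots> = (\<Sum>n\<in>carrier N. \<Sum>y\<in>F. block_ind n y * block_ind (\<nu> g \<otimes>\<^bsub>N\<^esub> n) (\<eta> g + y))"
      using \<nu>[OF g]
    proof
      assume "\<forall>h\<in>carrier G. \<nu> (g \<otimes>\<^bsub>G\<^esub> h) = \<nu> g \<otimes>\<^bsub>N\<^esub> \<nu> h"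
      then show ?thesis
        using g \<eta> by (simp flip: sum_G)
    next
      assume "\<forall>h\<in>carrier G. \<nu> (g \<otimes>\<^bsub>G\<^esub> h) = \<nu> g \<otimes>\<^bsub>N\<^esub> inv\<^bsub>N\<^esub> \<nu> h"
      then have "(\<Sum>d\<in>carrier G. block_ind (\<nu> d) (\<eta> d) * block_ind (\<nu> (g \<otimes>\<^bsub>G\<^esub> d)) (\<eta> (g \<otimes>\<^bsub>G\<^esub> d))) =
          (\<Sum>d\<in>carrier G. block_ind (\<nu> d) (\<eta> d) * block_ind (\<nu> g \<otimes>\<^bsub>N\<^esub> inv\<^bsub>N\<^esub> \<nu> d) (\<eta> g + \<eta> d))"
        using g \<eta> by simp
      also have "\<dots> = (\<Sum>n\<in>carrier N. \<Sum>y\<in>F. block_ind n y * block_ind (\<nu> g \<otimes>\<^bsub>N\<^esub> inv\<^bsub>N\<^esub> n) (\<eta> g + y))"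
        by (rule sum_G)
      also have "\<dots> = (\<Sum>n\<in>carrier N. \<Sum>y\<in>F. block_ind n y * block_ind (\<nu> g \<otimes>\<^bsub>N\<^esub> n) (\<eta> g + y))"
        by (rule sum.reindex_bij_witness[of _ "m_inv N" "m_inv N"]) (auto simp: block_ind_inv)
      finally show ?thesis .
    qed
    also have "\<dots> = (if \<eta> g = 0 then 2 * u - 1 else 2 * u - 2) *
        (2 * u * (2 * u - 2 + dual_sign (\<nu> g) (\<eta> g)) / 4)"
      using g u by (simp add: block_ind_correlation powR of_nat_diff)
    finally show ?thesis .
  qed

  have lambda: "card {(d1, d2). d1 \<in> D \<and> d2 \<in> D \<and> g = d1 \<otimes>\<^bsub>G\<^esub> inv\<^bsub>G\<^esub> d2} =
      u + (2 * u\<^sup>2 - u) * (u - 2)" if "g \<in> D - {\<one>\<^bsub>G\<^esub>}" for g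
  proof -
    have "real (card {(d1, d2). d1 \<in> D \<and> d2 \<in> D \<and> g = d1 \<otimes>\<^bsub>G\<^esub> inv\<^bsub>G\<^esub> d2}) =
        real (u + (2 * u\<^sup>2 - u) * (u - 2))"
    proof -
      have g: "g \<in> carrier G" "\<eta> g \<noteq> 0" "dual_sign (\<nu> g) (\<eta> g) = - 1"
        using that by (auto simp: mem_D)
      show ?thesis
        unfolding count[OF g(1)] g(3) of_nat_mult of_nat_add real_diffs
        using g(2) u by (simp add: of_nat_diff field_simps)
    qed
    then show ?thesis unfolding of_nat_eq_iff .
  qed
  have mu: "card {(d1, d2). d1 \<in> D \<and> d2 \<in> D \<and> g = d1 \<otimes>\<^bsub>G\<^esub> inv\<^bsub>G\<^esub> d2} =
      (2 * u\<^sup>2 - u) * (u - 1)" if g: "g \<in> carrier G - (D \<union> {\<one>\<^bsub>G\<^esub>})" for g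
  proof -
    have g': "g \<in> carrier G" using g by simp
    have "real (card {(d1, d2). d1 \<in> D \<and> d2 \<in> D \<and> g = d1 \<otimes>\<^bsub>G\<^esub> inv\<^bsub>G\<^esub> d2}) =
        real ((2 * u\<^sup>2 - u) * (u - 1))"
    \<comment> \<open>Outside the set, an element over 0 has correlation value 0 and any other has sign 1. The
      numbers of admissible fibres, \<open>2 u - 1\<close> and \<open>2 u - 2\<close>, compensate for the difference.\<close>
    proof (cases "\<eta> g = 0")
      case True
      then have "\<nu> g \<noteq> \<one>\<^bsub>N\<^esub>"
        using g g' inj[of g "\<one>\<^bsub>G\<^esub>"] \<eta>_one \<nu>_one by auto
      then have sig0: "dual_sign (\<nu> g) 0 = 0" using g' by (simp add: dual_sign_zero)
      show ?thesis
        unfolding count[OF g'] True sig0 of_nat_mult real_diffs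
        using u by (simp add: of_nat_diff field_simps)
    next
      case False
      then have sig1: "dual_sign (\<nu> g) (\<eta> g) = 1"
        using g g' dual_sign_nonzero[of "\<eta> g" "\<nu> g"] by (auto simp: mem_D)
      show ?thesis
        unfolding count[OF g'] sig1 of_nat_mult real_diffs
        using u False by (simp add: of_nat_diff field_simps)
    qed
    then show ?thesis unfolding of_nat_eq_iff .
  qed
  show ?thesis
    unfolding partial_difference_set_def
    unfolding D_def[symmetric] pow u_def[symmetric]
    using order card_D lambda mu fin D_subset \<open>group G\<close> by (simp only: pow) blast
qed

text \<open>The identification of \<open>C\<^sub>2\<^sup>r \<times> C\<^sub>2\<^sup>t\<^sup>-\<^sup>r\<close> with the additive group of \<open>F\<close>: the two vectors are
concatenated and read as basis coordinates.\<close>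

definition coordinate_sum :: "nat \<Rightarrow> (nat \<Rightarrow> int) \<Rightarrow> (nat \<Rightarrow> int) \<Rightarrow> 'a" where
  "coordinate_sum r a h = (\<Sum>i<t. of_int (if i < r then a i else h (i - r)) * \<alpha> i)"

lemma coordinate_sum_add:
  assumes "r + k = t"
  shows "coordinate_sum r (a \<otimes>\<^bsub>cyclic_power 2 r\<^esub> a') (h \<otimes>\<^bsub>cyclic_power 2 k\<^esub> h') =
    coordinate_sum r a h + coordinate_sum r a' h'"
  unfolding coordinate_sum_def sum.distrib[symmetric]
proof (intro sum.cong refl)
  fix i assume "i \<in> {..<t}"
  then have "i - r < k" if "\<not> i < r" using that assms by auto
  then show "of_int (if i < r then (a \<otimes>\<^bsub>cyclic_power 2 r\<^esub> a') i else (h \<otimes>\<^bsub>cyclic_power 2 k\<^esub> h') (i - r)) * \<alpha> i =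
      of_int (if i < r then a i else h (i - r)) * \<alpha> i + of_int (if i < r then a' i else h' (i - r)) * \<alpha> i"
    by (simp add: mult_cyclic_power distrib_right)
qed

lemma bij_betw_coordinate_sum:
  assumes "r + k = t"
  shows "bij_betw (\<lambda>(a, h). coordinate_sum r a h)
    (carrier (cyclic_power 2 r) \<times> carrier (cyclic_power 2 k)) F"
proof -
  let ?C = "carrier (cyclic_power 2 r) \<times> carrier (cyclic_power 2 k)"
  define v where "v = (\<lambda>(a :: nat \<Rightarrow> int, h :: nat \<Rightarrow> int) i. if i < r then a i else h (i - r))"
  define S where "S p = {i. i < t \<and> v p i = 1}" for p
  have v01: "v p i = 0 \<or> v p i = 1" if "p \<in> ?C" "i < t" for p i
  proof -
    have "fst p i \<in> {0..<2}" if "i < r"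
      using that \<open>p \<in> ?C\<close> by (auto simp: carrier_cyclic_power PiE_iff)
    moreover have "snd p (i - r) \<in> {0..<2}" if "\<not> i < r"
      using that \<open>p \<in> ?C\<close> \<open>i < t\<close> assms by (auto simp: carrier_cyclic_power PiE_iff)
    ultimately have "v p i \<in> {0..<2}" by (simp add: v_def case_prod_beta)
    then show ?thesis by auto
  qed
  have sum_S: "(case p of (a, h) \<Rightarrow> coordinate_sum r a h) = (\<Sum>i\<in>S p. \<alpha> i)" if "p \<in> ?C" for p
  proof -
    have "(case p of (a, h) \<Rightarrow> coordinate_sum r a h) = (\<Sum>i<t. of_int (v p i) * \<alpha> i)"
      by (simp add: coordinate_sum_def v_def case_prod_beta)
    also have "\<dots> = (\<Sum>i\<in>S p. \<alpha> i)"
      by (intro sum.mono_neutral_cong_right) (auto simp: S_def dest: v01[OF that])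
    finally show ?thesis .
  qed
  have inj: "inj_on (\<lambda>(a, h). coordinate_sum r a h) ?C"
  proof (rule inj_onI)
    fix p p' assume p: "p \<in> ?C" "p' \<in> ?C"
      and "(case p of (a, h) \<Rightarrow> coordinate_sum r a h) = (case p' of (a, h) \<Rightarrow> coordinate_sum r a h)"
    then have "(\<Sum>i\<in>S p. \<alpha> i) = (\<Sum>i\<in>S p'. \<alpha> i)" by (simp only: sum_S)
    then have "S p = S p'"
      using digits_unique[of "S p"] digits_unique[of "S p'"] by (auto simp: S_def)
    then have v_eq: "v p i = v p' i" if "i < t" for i
    proof -
      have "v p i = 1 \<longleftrightarrow> v p' i = 1"
        using \<open>S p = S p'\<close> that by (auto simp: S_def set_eq_iff)
      then show ?thesis using v01[OF p(1) that] v01[OF p(2) that] by auto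
    qed
    have fst_eq: "fst p i = fst p' i" if "i < r" for i
      using v_eq[of i] that assms by (simp add: v_def case_prod_beta)
    have snd_eq: "snd p i = snd p' i" if "i < k" for i
      using v_eq[of "r + i"] that assms by (simp add: v_def case_prod_beta)
    show "p = p'"
    proof (rule prod_eqI)
      show "fst p = fst p'"
        by (rule PiE_ext[of _ "{..<r}" "\<lambda>_. {0..<2}"])
           (use p fst_eq in \<open>simp_all add: carrier_cyclic_power mem_Times_iff\<close>)
      show "snd p = snd p'"
        by (rule PiE_ext[of _ "{..<k}" "\<lambda>_. {0..<2}"])
           (use p snd_eq in \<open>simp_all add: carrier_cyclic_power mem_Times_iff\<close>)
    qed
  qed
  have "(\<lambda>(a, h). coordinate_sum r a h) ` ?C = F"
  proof (rule card_subset_eq)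
    show "(\<lambda>(a, h). coordinate_sum r a h) ` ?C \<subseteq> F"
    proof (rule image_subsetI)
      fix p assume "p \<in> ?C"
      then have "(case p of (a, h) \<Rightarrow> coordinate_sum r a h) = (\<Sum>i\<in>S p. \<alpha> i)"
        by (rule sum_S)
      moreover have "S p \<in> Pow {..<t}" by (auto simp: S_def)
      ultimately show "(case p of (a, h) \<Rightarrow> coordinate_sum r a h) \<in> F"
        using bij_betwE[OF basis] by (simp only:)
    qed
    show "card ((\<lambda>(a, h). coordinate_sum r a h) ` ?C) = card F"
      using card_image[OF inj]
      by (simp add: card_cartesian_product card_cyclic_power card_F assms flip: power_add)
  qed simp
  with inj show ?thesis by (rule bij_betw_imageI)
qed

end

section \<open>The semidirect product\<close>

text \<open>The action through the first coordinate only: it inverts \<open>N\<close> and fixes \<open>M\<close>. One non-trivially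
acting coordinate suffices to make the semidirect product nonabelian, and with this action every
element acts on \<open>N\<close> as the identity or as inversion.\<close>

definition sign_action :: "('a, 'm) monoid_scheme \<Rightarrow> ('b, 'n) monoid_scheme \<Rightarrow> (nat \<Rightarrow> int) \<Rightarrow> 'a \<times> 'b \<Rightarrow> 'a \<times> 'b" where
  "sign_action N M h = (\<lambda>x\<in>carrier (N \<times>\<times> M). (if h 0 = 0 then fst x else inv\<^bsub>N\<^esub> fst x, snd x))"

lemma sign_action_hom:
  assumes "comm_group N" "group M" "k > 0"
  shows "sign_action N M \<in> hom (cyclic_power 2 k) (AutoGroup (N \<times>\<times> M))"
proof -
  interpret N: comm_group N by fact
  interpret M: group M by fact
  have closed: "sign_action N M h x \<in> carrier (N \<times>\<times> M)" if "x \<in> carrier (N \<times>\<times> M)" for h x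
    using that by (auto simp: sign_action_def)
  have invol: "sign_action N M h (sign_action N M h x) = x" if "x \<in> carrier (N \<times>\<times> M)" for h x
    using that by (auto simp: sign_action_def)
  have "sign_action N M h \<in> Bij (carrier (N \<times>\<times> M))" for h
  proof -
    have "bij_betw (sign_action N M h) (carrier (N \<times>\<times> M)) (carrier (N \<times>\<times> M))"
      by (rule bij_betw_byWitness[where f' = "sign_action N M h"]) (use closed invol in blast)+
    then show ?thesis by (simp add: Bij_def sign_action_def)
  qed
  moreover have "sign_action N M h \<in> hom (N \<times>\<times> M) (N \<times>\<times> M)" for h
    by (rule homI) (auto simp: sign_action_def N.inv_mult)
  moreover have "sign_action N M (h \<otimes>\<^bsub>cyclic_power 2 k\<^esub> h') =
      compose (carrier (N \<times>\<times> M)) (sign_action N M h) (sign_action N M h')"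
    if "h \<in> carrier (cyclic_power 2 k)" "h' \<in> carrier (cyclic_power 2 k)" for h h'
  proof -
    have "h 0 \<in> {0..<2}" "h' 0 \<in> {0..<2}"
      using that \<open>k > 0\<close> by (simp_all add: carrier_cyclic_power PiE_iff)
    then have "h 0 = 0 \<or> h 0 = 1" "h' 0 = 0 \<or> h' 0 = 1" by auto
    then show ?thesis
      using \<open>k > 0\<close> by (auto simp: sign_action_def compose_def mult_cyclic_power intro!: restrict_ext)
  qed
  ultimately show ?thesis
    by (auto simp: AutoGroup_def BijGroup_def auto_def intro!: homI)
qed

lemma not_comm_group_sign_action:
  assumes "t > 0" "k > 0" "group M"
  shows "\<not> comm_group (semidirect_product (cyclic_power 4 t \<times>\<times> M) (cyclic_power 2 k)
    (sign_action (cyclic_power 4 t) M))" (is "\<not> comm_group ?G")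
proof
  assume "comm_group ?G"
  then interpret comm_group ?G .
  let ?N = "cyclic_power 4 t" and ?H = "cyclic_power 2 k"
  interpret N: group ?N by (rule group_cyclic_power)
  interpret H: group ?H by (rule group_cyclic_power)
  interpret M: group M by fact
  define n :: "nat \<Rightarrow> int" where "n = (\<lambda>i\<in>{..<t}. 1)"
  define h :: "nat \<Rightarrow> int" where "h = (\<lambda>i\<in>{..<k}. 1)"
  have n: "n \<in> carrier ?N" and h: "h \<in> carrier ?H"
    by (auto simp: n_def h_def carrier_cyclic_power)
  have "((n, \<one>\<^bsub>M\<^esub>), \<one>\<^bsub>?H\<^esub>) \<otimes>\<^bsub>?G\<^esub> ((\<one>\<^bsub>?N\<^esub>, \<one>\<^bsub>M\<^esub>), h) = ((\<one>\<^bsub>?N\<^esub>, \<one>\<^bsub>M\<^esub>), h) \<otimes>\<^bsub>?G\<^esub> ((n, \<one>\<^bsub>M\<^esub>), \<one>\<^bsub>?H\<^esub>)"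
    using n h by (intro m_comm) (auto simp: semidirect_product_def)
  moreover have "h 0 = 1" "(\<one>\<^bsub>?H\<^esub>) 0 = 0"
    using \<open>k > 0\<close> by (auto simp: h_def one_cyclic_power)
  ultimately have "n = inv\<^bsub>?N\<^esub> n"
    using n h by (simp add: semidirect_product_def sign_action_def)
  then have "n 0 = (- n 0) mod 4"
    using inv_cyclic_power[OF n] \<open>t > 0\<close> by (metis lessThan_iff of_nat_numeral restrict_apply)
  then show False using \<open>t > 0\<close> by (simp add: n_def)
qed

theorem theorem6p5:
  fixes t k :: nat
  assumes "t \<ge> 2" and "1 \<le> k" and "k \<le> t"
  shows "\<exists>\<phi> (G :: (((nat \<Rightarrow> int) \<times> (nat \<Rightarrow> int)) \<times> (nat \<Rightarrow> int)) monoid).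
           \<phi> \<in> hom (cyclic_power 2 k)
                   (AutoGroup (cyclic_power 4 t \<times>\<times> cyclic_power 2 (t - k))) \<and>
           group G \<and> \<not> comm_group G \<and>
           G \<cong> semidirect_product (cyclic_power 4 t \<times>\<times> cyclic_power 2 (t - k))
                 (cyclic_power 2 k) \<phi> \<and>
           (\<exists>D. partial_difference_set G D
                  (2 ^ (3 * t))
                  ((2 ^ (2 * t - 1) - 2 ^ (t - 1)) * (2 ^ t - 1))
                  (2 ^ (t - 1) + (2 ^ (2 * t - 1) - 2 ^ (t - 1)) * (2 ^ (t - 1) - 2))
                  ((2 ^ (2 * t - 1) - 2 ^ (t - 1)) * (2 ^ (t - 1) - 1)))"
proof -
  let ?N = "cyclic_power 4 t" and ?M = "cyclic_power 2 (t - k)" and ?H = "cyclic_power 2 k"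
  define \<phi> where "\<phi> = sign_action ?N ?M"
  define G where "G = semidirect_product (?N \<times>\<times> ?M) ?H \<phi>"
  have k: "k > 0" "(t - k) + k = t" using assms by simp_all
  have \<phi>: "\<phi> \<in> hom ?H (AutoGroup (?N \<times>\<times> ?M))"
    unfolding \<phi>_def using k by (intro sign_action_hom comm_group_cyclic_power group_cyclic_power)
  then have "group G"
    unfolding G_def by (intro group_semidirect_product DirProd_group group_cyclic_power)
  have "\<not> comm_group G"
    unfolding G_def \<phi>_def using assms by (intro not_comm_group_sign_action group_cyclic_power) auto

  define F where "F = {x :: bit alg_closure. x ^ (2 ^ t) = x}"
  interpret binary_field F t
    using assms CHAR_bit_alg_closure card_roots_frobenius[OF CHAR_bit_alg_closure, of t]
    by unfold_locales (auto simp: F_def)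
  obtain \<alpha> where "bij_betw (\<lambda>S. \<Sum>i\<in>S. \<alpha> i) (Pow {..<t}) F"
    using basis_exists by blast
  then interpret binary_field_basis F t \<alpha>
    by unfold_locales
  define \<nu> where "\<nu> = (\<lambda>g :: ((nat \<Rightarrow> int) \<times> (nat \<Rightarrow> int)) \<times> (nat \<Rightarrow> int). fst (fst g))"
  define \<eta> where "\<eta> = (\<lambda>g :: ((nat \<Rightarrow> int) \<times> (nat \<Rightarrow> int)) \<times> (nat \<Rightarrow> int). coordinate_sum (t - k) (snd (fst g)) (snd g))"
  have carrier_G: "carrier G = (carrier ?N \<times> carrier ?M) \<times> carrier ?H"
    by (simp add: G_def semidirect_product_def)
  \<comment> \<open>The projections \<open>\<nu>\<close> and \<open>\<eta>\<close> exhibit \<open>G\<close> as \<open>C\<^sub>4\<^sup>t \<times> F\<close> twisted by inversion.\<close>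
  have "bij_betw (\<lambda>((n, a), h). (n, (a, h))) (carrier G) (carrier ?N \<times> (carrier ?M \<times> carrier ?H))"
    by (rule bij_betw_byWitness[where f' = "\<lambda>(n, (a, h)). ((n, a), h)"]) (auto simp: carrier_G)
  moreover have "bij_betw (map_prod id (\<lambda>(a, h). coordinate_sum (t - k) a h))
      (carrier ?N \<times> (carrier ?M \<times> carrier ?H)) (carrier ?N \<times> F)"
    using k by (intro bij_betw_map_prod bij_betw_coordinate_sum) auto
  ultimately have "bij_betw (map_prod id (\<lambda>(a, h). coordinate_sum (t - k) a h) \<circ>
      (\<lambda>((n, a), h). (n, (a, h)))) (carrier G) (carrier ?N \<times> F)"
    by (rule bij_betw_trans)
  then have bij: "bij_betw (\<lambda>g. (\<nu> g, \<eta> g)) (carrier G) (carrier ?N \<times> F)"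
    by (rule bij_betw_cong[THEN iffD1, rotated]) (auto simp: \<nu>_def \<eta>_def)
  have \<eta>_add: "\<eta> (g \<otimes>\<^bsub>G\<^esub> h) = \<eta> g + \<eta> h" if "g \<in> carrier G" "h \<in> carrier G" for g h
    using that k
    by (auto simp: carrier_G \<eta>_def G_def semidirect_product_def \<phi>_def sign_action_def coordinate_sum_add)
  have \<nu>_mult: "(\<forall>h\<in>carrier G. \<nu> (g \<otimes>\<^bsub>G\<^esub> h) = \<nu> g \<otimes>\<^bsub>?N\<^esub> \<nu> h) \<or>
      (\<forall>h\<in>carrier G. \<nu> (g \<otimes>\<^bsub>G\<^esub> h) = \<nu> g \<otimes>\<^bsub>?N\<^esub> inv\<^bsub>?N\<^esub> \<nu> h)" if "g \<in> carrier G" for g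
    using that
    by (cases "snd g 0 = 0") 
       (auto simp: carrier_G \<nu>_def G_def semidirect_product_def \<phi>_def sign_action_def)
  have iso: "G \<cong> semidirect_product (?N \<times>\<times> ?M) ?H \<phi>"
    unfolding G_def by (rule iso_refl)
  have "partial_difference_set G {g \<in> carrier G. \<eta> g \<noteq> 0 \<and> dual_sign (\<nu> g) (\<eta> g) = - 1}
      (2 ^ (3 * t))
      ((2 ^ (2 * t - 1) - 2 ^ (t - 1)) * (2 ^ t - 1))
      (2 ^ (t - 1) + (2 ^ (2 * t - 1) - 2 ^ (t - 1)) * (2 ^ (t - 1) - 2))
      ((2 ^ (2 * t - 1) - 2 ^ (t - 1)) * (2 ^ (t - 1) - 1))"
    using \<open>group G\<close> bij \<eta>_add \<nu>_mult \<open>t \<ge> 2\<close> by (rule partial_difference_set_of_twisted_product)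
  with \<phi> \<open>group G\<close> \<open>\<not> comm_group G\<close> iso show ?thesis
    by (intro exI[of _ \<phi>] exI[of _ G] conjI exI)
qed

end
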